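(* The Diophantine equation \[ (2am+1)^x+(2m)^y=(2am-1)^z \] has only the solutions $(a,m,x,y,z)=(2,1,2,1,3)$ and $(a,m,x,y,z)=(2,1,1,2,2)$ in positive integers $a,m,x,y,z$ with $a>1$. *)

theory Defs
  imports Main
begin

end

theory Submission
  imports Defs "HOL-Number_Theory.Number_Theory" "HOL-Computational_Algebra.Nth_Powers"
begin

text \<open>
  Write \<open>n = 2m\<close> and \<open>N = an\<close>, so that the equation is \<open>(N + 1)\<^sup>x + n\<^sup>y = (N - 1)\<^sup>z\<close>; modulo \<open>N\<close>
  it gives \<open>n\<^sup>y \<equiv> (-1)\<^sup>z - 1\<close>.

  If \<open>z\<close> is even, Jacobi symbols modulo \<open>N - 1\<close> and \<open>N + 1\<close> rule out \<open>8 | N\<close>, and for \<open>N \<equiv> 4 (mod 8)\<close>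
  they make \<open>x\<close> odd; then \<open>y = 2\<close> by reduction modulo 8, and the factorisation
  \<open>(N + 1)\<^sup>x = ((N - 1)\<^bsup>z/2\<^esup> - n)((N - 1)\<^bsup>z/2\<^esup> + n)\<close> into coprime factors forces \<open>x = 1\<close>. For \<open>N \<equiv> 2 (mod 4)\<close>
  all exponents turn out to be even, and factoring \<open>n\<^sup>y\<close> as a difference of squares twice leads to
  \<open>(n/2)\<^bsup>y/2\<^esup> = 4\<^sup>j + 1\<close>, which is impossible.

  If \<open>z\<close> is odd, then \<open>n = 2\<close>. Apart from \<open>y \<le> 2\<close>, congruences leave \<open>x\<close> and \<open>y\<close> even, and
  \<open>(N - 1)\<^sup>z\<close> is the sum of the squares of \<open>(N + 1)\<^bsup>x/2\<^esup>\<close> and \<open>2\<^bsup>y/2\<^esup>\<close>. In the Gaussian integers this makes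
  \<open>N - 1 = s\<^sup>2 + 2\<^sup>y\<close>, and \<open>N | 2\<^sup>y + 2\<close> gives \<open>s = \<plusminus>1\<close>. So the imaginary part of \<open>(1 + 2\<^bsup>y/2\<^esup> i)\<^sup>z\<close>
  is \<open>\<plusminus>2\<^bsup>y/2\<^esup>\<close>; the sign \<open>+\<close> is excluded 2-adically, the sign \<open>-\<close> modulo 16 and 5.
\<close>

section \<open>The Jacobi symbol\<close>

lemma prime_nat_of_int: "prime (p :: int) \<Longrightarrow> prime (nat p)"
  using prime_int_nat_transfer by blast

lemma eq_if_dvd_diff:
  fixes x y p :: int
  assumes "p dvd x - y" "\<bar>x - y\<bar> < p"
  shows "x = y"
  using assms dvd_imp_le_int[of "x - y" p] by fastforce

lemma Legendre_cong:
  assumes "[a = b] (mod p)"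
  shows "Legendre a p = Legendre b p"
proof -
  have "[a = 0] (mod p) \<longleftrightarrow> [b = 0] (mod p)"
    using assms by (meson cong_sym cong_trans)
  moreover have "QuadRes p a \<longleftrightarrow> QuadRes p b"
    unfolding QuadRes_def using assms by (meson cong_sym cong_trans)
  ultimately show ?thesis by (simp add: Legendre_def)
qed

text \<open>By Euler's criterion both sides are congruent to \<open>(a * b) ^ e\<close> modulo
  \<open>p\<close>. Their values lie in {-1, 0, 1}, so they differ by at most 2, which is less than
  \<open>p\<close>.\<close>

lemma Legendre_mult:
  fixes p :: int
  assumes p: "prime p" "p > 2"
  shows "Legendre (a * b) p = Legendre a p * Legendre b p"
proof -
  have pn: "prime (nat p)" "2 < nat p" "int (nat p) = p"
    using p by (simp_all add: prime_nat_of_int)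
  define e where "e = (nat p - 1) div 2"
  have eu: "[Legendre c p = c ^ e] (mod p)" for c
    using euler_criterion[of "nat p" c] pn by (simp add: e_def)
  have "[Legendre a p * Legendre b p = (a * b) ^ e] (mod p)"
    unfolding power_mult_distrib by (intro cong_mult eu)
  then have "[Legendre (a * b) p = Legendre a p * Legendre b p] (mod p)"
    using cong_trans[OF eu cong_sym] by blast
  then have "p dvd Legendre (a * b) p - Legendre a p * Legendre b p"
    by (simp add: cong_iff_dvd_diff)
  moreover have "\<bar>Legendre (a * b) p - Legendre a p * Legendre b p\<bar> < p"
    using p by (auto simp: Legendre_def)
  ultimately show ?thesis
    by (rule eq_if_dvd_diff)
qed

text \<open>Prime factors count with multiplicity, so for odd positive \<open>n\<close> this is the
  usual Jacobi symbol.\<close>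

definition jacobi :: "int \<Rightarrow> int \<Rightarrow> int" where
  "jacobi a n = (\<Prod>p\<in>#prime_factorization n. Legendre a p)"

lemma jacobi_1_right [simp]: "jacobi a 1 = 1"
  by (simp add: jacobi_def)

lemma jacobi_prime: "prime p \<Longrightarrow> jacobi a p = Legendre a p"
  by (simp add: jacobi_def prime_factorization_prime)

lemma jacobi_mult_right:
  "m \<noteq> 0 \<Longrightarrow> n \<noteq> 0 \<Longrightarrow> jacobi a (m * n) = jacobi a m * jacobi a n"
  by (simp add: jacobi_def prime_factorization_mult)

lemma jacobi_cong:
  assumes "[a = b] (mod n)"
  shows "jacobi a n = jacobi b n"
  unfolding jacobi_def
proof (rule arg_cong[of _ _ prod_mset], rule image_mset_cong)
  fix p assume "p \<in># prime_factorization n"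
  then have "p dvd n" by auto
  then show "Legendre a p = Legendre b p"
    using assms Legendre_cong cong_dvd_modulus by blast
qed

text \<open>Stripping odd primes off \<open>n\<close> is how facts about Legendre symbols are
  carried over to Jacobi symbols.\<close>

lemma odd_int_prime_induct [consumes 2, case_names one mult]:
  fixes n :: int
  assumes "odd n" "n > 0"
    and "P 1"
    and "\<And>p n. prime p \<Longrightarrow> p > 2 \<Longrightarrow> odd p \<Longrightarrow> odd n \<Longrightarrow> n > 0 \<Longrightarrow> P n \<Longrightarrow> P (p * n)"
  shows "P n"
proof -
  have "odd n \<and> n > 0 \<longrightarrow> P n"
  proof (induction n rule: prime_divisors_induct)
    case (unit x)
    then show ?case using assms(3) by auto
  next
    case (factor p x)
    show ?case
    proof
      assume *: "odd (p * x) \<and> p * x > 0"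
      have p: "p \<ge> 2" "odd p" using factor * prime_ge_2_int by auto
      then have "x > 0" using * by (simp add: zero_less_mult_iff)
      moreover have "p > 2" using p by (cases "p = 2") auto
      ultimately show "P (p * x)" using assms(4) factor * p by simp
    qed
  qed auto
  then show ?thesis using assms by simp
qed

lemma jacobi_mult_left:
  assumes "odd n" "n > 0"
  shows "jacobi (a * b) n = jacobi a n * jacobi b n"
  using assms
proof (induction n rule: odd_int_prime_induct)
  case (mult p n)
  then show ?case by (simp add: jacobi_mult_right jacobi_prime Legendre_mult)
qed simp

lemma jacobi_1_left [simp]:
  assumes "odd n" "n > 0"
  shows "jacobi 1 n = 1"
  using assms
proof (induction n rule: odd_int_prime_induct)
  case (mult p n)
  have "QuadRes p 1" unfolding QuadRes_def by (metis cong_refl one_power2)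
  moreover have "\<not> [1 = 0] (mod p)" using mult by (simp add: cong_iff_dvd_diff)
  ultimately show ?case using mult by (simp add: jacobi_mult_right jacobi_prime Legendre_def)
qed simp

lemma jacobi_power_left:
  assumes "odd n" "n > 0"
  shows "jacobi (a ^ k) n = jacobi a n ^ k"
  by (induction k) (use assms in \<open>simp_all add: jacobi_mult_left\<close>)

lemma odd_mod_4: "odd (k :: int) \<Longrightarrow> k mod 4 = 1 \<or> k mod 4 = 3"
  by presburger

text \<open>\<open>(p - 1) div 2\<close> is the exponent of -1 in Euler's criterion and in the
  reciprocity law, where only its parity matters.\<close>

lemma odd_nat_half_iff:
  fixes p :: int
  assumes "odd p" "p > 2"
  shows "odd (nat ((p - 1) div 2)) \<longleftrightarrow> p mod 4 = 3"
proof -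
  have "odd (nat ((p - 1) div 2)) \<longleftrightarrow> odd ((p - 1) div 2)"
    using assms by (simp add: even_nat_iff)
  also have "\<dots> \<longleftrightarrow> p mod 4 = 3" using assms by presburger
  finally show ?thesis .
qed

lemma odd_mult_mod_4:
  fixes m n :: int
  assumes "odd m" "odd n"
  shows "(m * n) mod 4 = 1 \<longleftrightarrow> m mod 4 = n mod 4"
proof -
  have "m mod 4 = 1 \<or> m mod 4 = 3" "n mod 4 = 1 \<or> n mod 4 = 3" using assms by presburger+
  moreover have "(m * n) mod 4 = ((m mod 4) * (n mod 4)) mod 4" by (simp add: mod_mult_eq)
  ultimately show ?thesis by auto
qed

lemma jacobi_minus_1:
  assumes "odd n" "n > 0"
  shows "jacobi (-1) n = (if n mod 4 = 1 then 1 else -1)"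
  using assms
proof (induction n rule: odd_int_prime_induct)
  case (mult p n)
  have pn: "prime (nat p)" "2 < nat p" "int (nat p) = p"
    using mult by (simp_all add: prime_nat_of_int)
  have "[Legendre (-1) p = (-1) ^ ((nat p - 1) div 2)] (mod p)"
    using euler_criterion[of "nat p" "-1"] pn by simp
  moreover have "(nat p - 1) div 2 = nat ((p - 1) div 2)"
    using pn by linarith
  then have "even ((nat p - 1) div 2) \<longleftrightarrow> p mod 4 = 1"
    using mult odd_nat_half_iff[of p] odd_mod_4[of p] by auto
  ultimately have "p dvd Legendre (-1) p - (if p mod 4 = 1 then 1 else -1)"
    by (auto simp: cong_iff_dvd_diff split: if_splits)
  moreover have "\<bar>Legendre (-1) p - (if p mod 4 = 1 then 1 else -1)\<bar> < p"
    using mult by (auto simp: Legendre_def)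
  ultimately have L: "Legendre (-1) p = (if p mod 4 = 1 then 1 else -1)"
    by (rule eq_if_dvd_diff)
  have "p mod 4 = 1 \<or> p mod 4 = 3" "n mod 4 = 1 \<or> n mod 4 = 3"
    using mult odd_mod_4 by auto
  then show ?case
    using mult L odd_mult_mod_4[of p n] by (auto simp: jacobi_mult_right jacobi_prime)
qed simp

section \<open>Quadratic reciprocity and the symbol of 2\<close>

text \<open>For odd \<open>m\<close> and \<open>n\<close> this is -1 to the power (m - 1)/2 * (n -
  1)/2, read off from the residues modulo 4.\<close>

definition qr_sign :: "int \<Rightarrow> int \<Rightarrow> int" where
  "qr_sign m n = (if m mod 4 = 3 \<and> n mod 4 = 3 then -1 else 1)"

lemma qr_sign_commute: "qr_sign m n = qr_sign n m"
  by (auto simp: qr_sign_def)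

lemma qr_sign_mult:
  assumes "odd m" "odd n"
  shows "qr_sign k (m * n) = qr_sign k m * qr_sign k n"
proof -
  have "m mod 4 = 1 \<or> m mod 4 = 3" "n mod 4 = 1 \<or> n mod 4 = 3" "(m * n) mod 4 = 1 \<or> (m * n) mod 4 = 3"
    using assms by (auto intro!: odd_mod_4)
  then show ?thesis using odd_mult_mod_4[OF assms] by (auto simp: qr_sign_def)
qed

lemma Legendre_reciprocity:
  fixes p q :: int
  assumes "prime p" "p > 2" "prime q" "q > 2" "p \<noteq> q"
  shows "Legendre p q = qr_sign p q * Legendre q p"
proof -
  have "odd p" "odd q" using assms prime_odd_int by auto
  have "Legendre p q * Legendre q p = (-1) ^ nat ((p - 1) div 2 * ((q - 1) div 2))"
    using assms by (intro Quadratic_Reciprocity_int) (simp_all add: prime_nat_of_int)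
  also have "nat ((p - 1) div 2 * ((q - 1) div 2)) = nat ((p - 1) div 2) * nat ((q - 1) div 2)"
    using assms by (simp add: nat_mult_distrib)
  also have "(-1::int) ^ (nat ((p - 1) div 2) * nat ((q - 1) div 2)) = qr_sign p q"
  proof -
    have "odd (nat ((p - 1) div 2)) \<longleftrightarrow> p mod 4 = 3" "odd (nat ((q - 1) div 2)) \<longleftrightarrow> q mod 4 = 3"
      using assms \<open>odd p\<close> \<open>odd q\<close> by (simp_all add: odd_nat_half_iff)
    then show ?thesis by (auto simp: qr_sign_def)
  qed
  finally have *: "Legendre p q * Legendre q p = qr_sign p q" .
  then show ?thesis
    by (auto simp: Legendre_def qr_sign_def split: if_splits)
qed

text \<open>Both sides are multiplicative in \<open>m\<close> and in \<open>n\<close>, so a nested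
  induction over the prime factors reduces the claim to the law for two primes, which are distinct
  by coprimality.\<close>

lemma jacobi_reciprocity:
  assumes "odd m" "m > 0" "odd n" "n > 0" "coprime m n"
  shows "jacobi m n = qr_sign m n * jacobi n m"
  using assms
proof (induction m rule: odd_int_prime_induct)
  case one
  then show ?case by (simp add: qr_sign_def)
next
  case (mult p m)
  have "jacobi p n = qr_sign p n * jacobi n p"
    using \<open>odd n\<close> \<open>n > 0\<close> \<open>coprime (p * m) n\<close>
  proof (induction n rule: odd_int_prime_induct)
    case one
    then show ?case using mult by (simp add: qr_sign_def)
  next
    case (mult q n)
    have "p \<noteq> q"
      using mult(7) \<open>prime p\<close> by auto
    then have "Legendre p q = qr_sign p q * Legendre q p"
      using mult \<open>prime p\<close> \<open>p > 2\<close> by (intro Legendre_reciprocity)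
    moreover have "coprime (p * m) n" using mult by simp
    ultimately show ?case
      using mult \<open>prime p\<close> \<open>p > 2\<close> \<open>odd p\<close>
      by (simp add: jacobi_mult_right jacobi_mult_left jacobi_prime Legendre_mult[of p] qr_sign_mult)
  qed
  moreover have "coprime m n" using mult by simp
  ultimately show ?case
    using mult by (simp add: jacobi_mult_right jacobi_mult_left qr_sign_mult[of p m n] qr_sign_commute[of _ n])
qed

text \<open>Descent from \<open>n\<close> to \<open>n - 2\<close>: 2 is congruent to
  \<open>-(n - 2)\<close> modulo \<open>n\<close>, reciprocity inverts the symbol of
  \<open>n - 2\<close>, and \<open>n\<close> is congruent to 2 modulo \<open>n - 2\<close>. The
  reciprocity sign is 1, since \<open>n - 2\<close> and \<open>n\<close> are not both 3 modulo
  4.\<close>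

lemma jacobi_2:
  assumes "odd n" "n > 0"
  shows "jacobi 2 n = (if n mod 8 = 1 \<or> n mod 8 = 7 then 1 else -1)"
  using assms
proof (induction "nat n" arbitrary: n rule: less_induct)
  case less
  show ?case
  proof (cases "n = 1")
    case True
    then show ?thesis by simp
  next
    case False
    then have n: "n \<ge> 3" using less by presburger
    have "gcd (n - 2) n = gcd 2 n"
      using gcd_diff1[of n 2] by (metis gcd.commute gcd_diff2)
    then have cop: "coprime (n - 2) n"
      using less(2) by (simp add: coprime_iff_gcd_eq_1[symmetric])
    have "[2 = (-1) * (n - 2)] (mod n)" by (simp add: cong_iff_dvd_diff)
    then have "jacobi 2 n = jacobi (-1) n * jacobi (n - 2) n"
      using jacobi_cong jacobi_mult_left less by metis
    also have "jacobi (n - 2) n = qr_sign (n - 2) n * jacobi n (n - 2)"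
      using less n cop by (intro jacobi_reciprocity) auto
    also have "qr_sign (n - 2) n = 1" unfolding qr_sign_def by presburger
    also have "jacobi n (n - 2) = jacobi 2 (n - 2)" by (rule jacobi_cong) (simp add: cong_iff_dvd_diff)
    also have "\<dots> = (if (n - 2) mod 8 = 1 \<or> (n - 2) mod 8 = 7 then 1 else -1)"
      using less n by (intro less(1)) auto
    finally have *: "jacobi 2 n = (if n mod 4 = 1 then 1 else -1) *
        (if (n - 2) mod 8 = 1 \<or> (n - 2) mod 8 = 7 then 1 else -1)"
      using less by (simp add: jacobi_minus_1)
    have m: "n mod 4 = (n mod 8) mod 4" "(n - 2) mod 8 = (n mod 8 - 2) mod 8"
      by (simp_all add: mod_mod_cancel mod_diff_left_eq)
    have "n mod 8 = 1 \<or> n mod 8 = 3 \<or> n mod 8 = 5 \<or> n mod 8 = 7"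
      using less(2) by presburger
    then show ?thesis
      unfolding * m by (elim disjE) simp_all
  qed
qed

section \<open>Powers of Gaussian integers\<close>

text \<open>\<open>(s + \<surd>-T)\<^sup>k = quad_re s T k + quad_im s T k \<cdot> \<surd>-T\<close>; for \<open>T = t\<^sup>2\<close> these are the powers of
  the Gaussian integer \<open>s + t i\<close>.\<close>

fun quad_re quad_im :: "int \<Rightarrow> int \<Rightarrow> nat \<Rightarrow> int" where
  "quad_re s T 0 = 1"
| "quad_im s T 0 = 0"
| "quad_re s T (Suc k) = s * quad_re s T k - T * quad_im s T k"
| "quad_im s T (Suc k) = quad_re s T k + s * quad_im s T k"

section \<open>Sums of two squares that are powers\<close>

lemma exists_floor_sqrt: "\<exists>q :: nat. q\<^sup>2 \<le> n \<and> n < (Suc q)\<^sup>2"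
proof (induction n)
  case (Suc n)
  then obtain q where q: "q\<^sup>2 \<le> n" "n < (Suc q)\<^sup>2" by blast
  show ?case
  proof (cases "Suc n < (Suc q)\<^sup>2")
    case False
    then have "Suc n = (Suc q)\<^sup>2" using q by simp
    then show ?thesis by (intro exI[of _ "Suc q"]) (simp add: power2_eq_square)
  qed (use q in \<open>auto intro: exI[of _ q]\<close>)
qed simp

text \<open>Thue's pigeonhole argument: the more than \<open>c\<close> pairs with entries in
  \<open>{0..q}\<close> collide modulo \<open>c\<close>, and the difference \<open>(s, t)\<close> of
  two colliding pairs is small enough that \<open>s^2 + t^2\<close> is \<open>c\<close> or
  \<open>2 * c\<close>.\<close>

lemma thue_sum_two_squares:
  fixes A B c :: int
  assumes c: "odd c" "c > 1" and cop: "coprime B c" and dvd: "c dvd A\<^sup>2 + B\<^sup>2"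
  shows "\<exists>s t. s\<^sup>2 + t\<^sup>2 = c \<and> c dvd A * t - B * s"
proof -
  obtain q' where q': "q'\<^sup>2 \<le> nat c" "nat c < (Suc q')\<^sup>2" using exists_floor_sqrt by blast
  define q where "q = int q'"
  have "int (q'\<^sup>2) \<le> c" "c < int ((Suc q')\<^sup>2)" using q' c by linarith+
  then have q: "q\<^sup>2 \<le> c" "c < (q + 1)\<^sup>2" "q \<ge> 0" by (simp_all add: q_def add.commute)
  define f where "f = (\<lambda>(i, j). (A * j - B * i) mod c)"
  have "\<not> inj_on f ({0..q} \<times> {0..q})"
  proof
    assume "inj_on f ({0..q} \<times> {0..q})"
    moreover have "f ` ({0..q} \<times> {0..q}) \<subseteq> {0..<c}" using c by (auto simp: f_def)
    ultimately have "card ({0..q} \<times> {0..q}) \<le> card {0..<c}" by (rule card_inj_on_le) simp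
    then have "nat (q + 1) * nat (q + 1) \<le> nat c" by (simp add: card_cartesian_product)
    then have "(q + 1) * (q + 1) \<le> c" using q c by (simp add: nat_mult_distrib[symmetric])
    then show False using q by (simp add: power2_eq_square)
  qed
  then obtain i j i' j' where ij: "i \<in> {0..q}" "j \<in> {0..q}" "i' \<in> {0..q}" "j' \<in> {0..q}"
    "(A * j - B * i) mod c = (A * j' - B * i') mod c" "(i, j) \<noteq> (i', j')"
    unfolding inj_on_def f_def by auto
  define s t where "s = i - i'" and "t = j - j'"
  have "c dvd (A * j - B * i) - (A * j' - B * i')" using ij(5) by (simp add: mod_eq_dvd_iff)
  then have st: "c dvd A * t - B * s" by (simp add: s_def t_def algebra_simps)
  have "\<bar>s\<bar> \<le> \<bar>q\<bar>" "\<bar>t\<bar> \<le> \<bar>q\<bar>" using ij by (auto simp: s_def t_def)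
  then have le: "s\<^sup>2 \<le> q\<^sup>2" "t\<^sup>2 \<le> q\<^sup>2" by (simp_all only: abs_le_square_iff)
  have "s \<noteq> 0 \<or> t \<noteq> 0" using ij(6) by (auto simp: s_def t_def)
  then have pos: "s\<^sup>2 + t\<^sup>2 > 0" by (simp add: sum_power2_gt_zero_iff)
  \<comment> \<open>This identity transfers divisibility by \<open>c\<close> to
    \<open>s^2 + t^2\<close>, as \<open>B\<close> is coprime to \<open>c\<close>.\<close>
  have "B\<^sup>2 * (s\<^sup>2 + t\<^sup>2) = t\<^sup>2 * (A\<^sup>2 + B\<^sup>2) - (A * t - B * s) * (A * t + B * s)"
    by (simp add: algebra_simps power2_eq_square)
  then have "c dvd B\<^sup>2 * (s\<^sup>2 + t\<^sup>2)" using st dvd by simp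
  then have "c dvd s\<^sup>2 + t\<^sup>2" using cop by (simp add: coprime_dvd_mult_right_iff coprime_commute)
  then obtain k where k: "s\<^sup>2 + t\<^sup>2 = c * k" by blast
  have ck: "c * k \<le> c * 2" "c * k > 0" using k le q pos by linarith+
  have "k \<le> 2" using mult_le_cancel_left_pos[of c k 2] ck c by linarith
  moreover have "k > 0" using ck c by (simp add: zero_less_mult_iff)
  moreover have "k \<noteq> 2"
  proof
    assume "k = 2"
    then have eq: "s\<^sup>2 = q\<^sup>2" "t\<^sup>2 = q\<^sup>2" "c = q\<^sup>2" using k[unfolded \<open>k = 2\<close>] le q by simp_all
    then have "s = q \<or> s = -q" "t = q \<or> t = -q" by (simp_all add: power2_eq_iff)
    moreover have "q * q dvd A * t - B * s" using st eq by (simp add: power2_eq_square)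
    moreover have "q \<noteq> 0" using eq c by auto
    \<comment> \<open>One factor \<open>q\<close> cancels. Then \<open>q\<close> divides both
      \<open>A^2 - B^2\<close> and \<open>A^2 + B^2\<close>, hence \<open>2 * B^2\<close>, to which
      it is coprime; so \<open>c = q^2\<close> would be 1.\<close>
    ultimately have "q dvd A - B \<or> q dvd A + B"
    proof (elim disjE)
      assume "s = q" "t = q" "q * q dvd A * t - B * s" "q \<noteq> 0"
      then have "q * q dvd q * (A - B)" by (simp add: algebra_simps)
      then show ?thesis using \<open>q \<noteq> 0\<close> by simp
    next
      assume "s = q" "t = -q" "q * q dvd A * t - B * s" "q \<noteq> 0"
      then have "q * q dvd - (q * (A + B))" by (simp add: algebra_simps)
      then show ?thesis using \<open>q \<noteq> 0\<close> by (simp only: dvd_minus_iff dvd_mult_cancel_left) simp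
    next
      assume "s = -q" "t = q" "q * q dvd A * t - B * s" "q \<noteq> 0"
      then have "q * q dvd q * (A + B)" by (simp add: algebra_simps)
      then show ?thesis using \<open>q \<noteq> 0\<close> by simp
    next
      assume "s = -q" "t = -q" "q * q dvd A * t - B * s" "q \<noteq> 0"
      then have "q * q dvd - (q * (A - B))" by (simp add: algebra_simps)
      then show ?thesis using \<open>q \<noteq> 0\<close> by (simp only: dvd_minus_iff dvd_mult_cancel_left) simp
    qed
    then have "q dvd (A - B) * (A + B)" by auto
    moreover have "q dvd A\<^sup>2 + B\<^sup>2" using dvd eq by (metis dvd_trans dvd_power zero_less_numeral)
    ultimately have "q dvd (A\<^sup>2 + B\<^sup>2) - (A - B) * (A + B)" by (rule dvd_diff[rotated])
    moreover have "(A\<^sup>2 + B\<^sup>2) - (A - B) * (A + B) = 2 * B\<^sup>2" by (simp add: algebra_simps power2_eq_square)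
    moreover have "coprime q 2" using c eq by simp
    moreover have "coprime q (B\<^sup>2)" using cop eq by (simp add: coprime_commute)
    ultimately have "q dvd 1"
      by (metis coprime_dvd_mult_right_iff coprime_common_divisor dvd_refl)
    then show False using eq c q by auto
  qed
  ultimately have "k = 1" by linarith
  then show ?thesis using k st by auto
qed

text \<open>The numbers \<open>A * s + B * t\<close> and \<open>-(A * t - B * s)\<close> are the
  real and imaginary parts of \<open>(A + B i)(s - t i)\<close>. The norm of this product and the
  square of its imaginary part are divisible by \<open>c^2\<close>, hence so is the square of the
  real part.\<close>

lemma square_dvd_sum_two_squares:
  fixes A B s t c :: int
  assumes "s\<^sup>2 + t\<^sup>2 = c" "c dvd A * t - B * s" "A\<^sup>2 + B\<^sup>2 = c ^ Suc k"
  shows "c dvd A * s + B * t"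
proof -
  have "(A * s + B * t)\<^sup>2 = (A\<^sup>2 + B\<^sup>2) * (s\<^sup>2 + t\<^sup>2) - (A * t - B * s)\<^sup>2"
    by (simp add: algebra_simps power2_eq_square)
  also have "\<dots> = c ^ k * c\<^sup>2 - (A * t - B * s)\<^sup>2"
    using assms by (simp add: power2_eq_square)
  finally have "c\<^sup>2 dvd (A * s + B * t)\<^sup>2"
    using assms(2) by simp
  then show ?thesis by (simp add: pow_divides_pow_iff)
qed

text \<open>No unique factorisation is needed here: once a divisor \<open>s + t i\<close> of norm \<open>c\<close> has been split off,
  coprimality of \<open>B\<close> and \<open>c\<close> forces the same divisor to split off again.\<close>

lemma sum_two_squares_eq_power:
  fixes A B s t c :: int
  assumes "s\<^sup>2 + t\<^sup>2 = c" "c > 0" "A\<^sup>2 + B\<^sup>2 = c ^ k"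
    and "k > 0 \<Longrightarrow> c dvd A * t - B * s" "k > 0 \<Longrightarrow> coprime B c"
  shows "\<exists>C D. C\<^sup>2 + D\<^sup>2 = 1 \<and> A = C * quad_re s (t\<^sup>2) k - D * (t * quad_im s (t\<^sup>2) k)
    \<and> B = C * (t * quad_im s (t\<^sup>2) k) + D * quad_re s (t\<^sup>2) k"
  using assms(3-5)
proof (induction k arbitrary: A B)
  case (Suc k)
  note c = assms(1,2)
  have "c dvd A * t - B * s" using Suc.prems by simp
  moreover from this have "c dvd A * s + B * t"
    using square_dvd_sum_two_squares[OF assms(1)] Suc.prems by blast
  \<comment> \<open>\<open>A' + B' i\<close> is the quotient of \<open>A + B i\<close> by
    \<open>s + t i\<close>.\<close>
  ultimately obtain A' B' where A': "A * s + B * t = c * A'" and B': "A * t - B * s = - c * B'"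
    by (metis dvdE dvd_minus_iff minus_mult_left minus_minus)
  have "c * A = c * (A' * s - B' * t)"
  proof -
    have "c * A = (A * s + B * t) * s + (A * t - B * s) * t"
      unfolding c(1)[symmetric] by (simp add: algebra_simps power2_eq_square)
    then show ?thesis unfolding A' B' by (simp add: algebra_simps)
  qed
  then have A: "A = A' * s - B' * t" using c by simp
  have "c * B = c * (A' * t + B' * s)"
  proof -
    have "c * B = (A * s + B * t) * t - (A * t - B * s) * s"
      unfolding c(1)[symmetric] by (simp add: algebra_simps power2_eq_square)
    then show ?thesis unfolding A' B' by (simp add: algebra_simps)
  qed
  then have B: "B = A' * t + B' * s" using c by simp
  have "A\<^sup>2 + B\<^sup>2 = (A'\<^sup>2 + B'\<^sup>2) * c"
    unfolding A B c(1)[symmetric] by (simp add: algebra_simps power2_eq_square)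
  then have norm: "A'\<^sup>2 + B'\<^sup>2 = c ^ k" using Suc.prems c by simp
  have cop: "coprime B c" using Suc.prems by simp
  \<comment> \<open>This and the next claim pass the hypotheses on to the quotient. Here multiplying
    by \<open>B\<close> produces an expression in the norms \<open>c\<close> and
    \<open>c ^ k\<close>.\<close>
  have 1: "c dvd A' * t - B' * s" if "k > 0"
  proof -
    have "(A' * t - B' * s) * B = A'\<^sup>2 * (s\<^sup>2 + t\<^sup>2) - s\<^sup>2 * (A'\<^sup>2 + B'\<^sup>2)"
      unfolding B by (simp add: algebra_simps power2_eq_square)
    also have "\<dots> = A'\<^sup>2 * c - s\<^sup>2 * c ^ k" by (simp only: norm c(1))
    finally have "(A' * t - B' * s) * B = A'\<^sup>2 * c - s\<^sup>2 * c ^ k" .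
    then have "c dvd (A' * t - B' * s) * B" using that by (simp add: dvd_power)
    then show ?thesis using cop by (simp add: coprime_dvd_mult_left_iff coprime_commute)
  qed
  \<comment> \<open>A common divisor of \<open>B'\<close> and \<open>c\<close> divides
    \<open>A'^2\<close> by the norm equation, hence also \<open>B * B\<close>.\<close>
  have 2: "coprime B' c" if "k > 0"
  proof (rule coprimeI)
    fix g assume g: "g dvd B'" "g dvd c"
    then have "g dvd c ^ k - B'\<^sup>2" using that by (simp add: power2_eq_square dvd_power dvd_trans[OF _ dvd_power])
    then have "g dvd A'\<^sup>2" using norm by (metis add_diff_cancel_right')
    moreover have "B * B = A'\<^sup>2 * t\<^sup>2 + B' * (2 * A' * t * s + B' * s\<^sup>2)"
      unfolding B by (simp add: algebra_simps power2_eq_square)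
    ultimately have "g dvd B * B" using g by simp
    moreover have "coprime (B * B) c" using cop by simp
    ultimately show "is_unit g" using g coprime_common_divisor by blast
  qed
  obtain C D where CD: "C\<^sup>2 + D\<^sup>2 = 1" "A' = C * quad_re s (t\<^sup>2) k - D * (t * quad_im s (t\<^sup>2) k)"
    "B' = C * (t * quad_im s (t\<^sup>2) k) + D * quad_re s (t\<^sup>2) k"
    using Suc.IH[OF norm 1 2] by blast
  show ?case
    using CD(1) unfolding A B CD(2,3) by (intro exI[of _ C] exI[of _ D]) (simp add: algebra_simps power2_eq_square)
qed auto

lemma quad_parity:
  assumes "odd s" "even T"
  shows "odd (quad_re s T k)" "odd (quad_im s T k) \<longleftrightarrow> odd k"
  using assms by (induction k) auto

text \<open>With \<open>t\<close> even, the parity of \<open>B\<close> makes the imaginary part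
  \<open>D\<close> of the unit even. A unit has norm 1, so \<open>D = 0\<close> and the unit is 1 or
  -1.\<close>

lemma odd_even_squares_eq_power:
  fixes A B c :: int
  assumes c: "odd c" "c > 1" and cop: "coprime B c" and AB: "odd A" "even B"
    and eq: "A\<^sup>2 + B\<^sup>2 = c ^ k" "k > 0"
  shows "\<exists>s t. s\<^sup>2 + t\<^sup>2 = c \<and> even t \<and> \<bar>A\<bar> = \<bar>quad_re s (t\<^sup>2) k\<bar> \<and> \<bar>B\<bar> = \<bar>t * quad_im s (t\<^sup>2) k\<bar>"
proof -
  obtain k' where k': "k = Suc k'" using eq(2) gr0_implies_Suc by blast
  have "c dvd A\<^sup>2 + B\<^sup>2" using eq by (simp add: dvd_power)
  then obtain s t where st: "s\<^sup>2 + t\<^sup>2 = c" "c dvd A * t - B * s"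
    using thue_sum_two_squares[OF c cop] by blast
  obtain s t where st: "s\<^sup>2 + t\<^sup>2 = c" "c dvd A * t - B * s" "even t"
  proof (cases "even t")
    case False
    then have "even s" using st(1) c by auto
    moreover have "c dvd A * s + B * t"
      using square_dvd_sum_two_squares[OF st] eq k' by blast
    \<comment> \<open>Multiplying \<open>s + t i\<close> by \<open>i\<close> gives
      \<open>-t + s i\<close>, which swaps the parities.\<close>
    ultimately show ?thesis using that[of "-t" s] st by (simp add: add.commute)
  qed (use st that in blast)
  then have "odd s" using c by auto
  obtain C D where CD: "C\<^sup>2 + D\<^sup>2 = 1" "A = C * quad_re s (t\<^sup>2) k - D * (t * quad_im s (t\<^sup>2) k)"
    "B = C * (t * quad_im s (t\<^sup>2) k) + D * quad_re s (t\<^sup>2) k"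
    using sum_two_squares_eq_power[OF st(1) _ eq(1)] c st cop by auto
  have "even D" using CD(3) AB quad_parity(1)[of s "t\<^sup>2" k] \<open>odd s\<close> st(3) by auto
  have "D = 0"
  proof (rule ccontr)
    assume "D \<noteq> 0"
    then have "\<bar>D\<bar> \<ge> 2" using \<open>even D\<close> by presburger
    then have "D\<^sup>2 \<ge> 4" using abs_le_square_iff[of 2 D] by simp
    then show False using CD(1) zero_le_power2[of C] by linarith
  qed
  then have "\<bar>C\<bar> = 1" using CD(1) by (simp add: power2_eq_1_iff) auto
  then show ?thesis using CD \<open>D = 0\<close> st by (intro exI[of _ s] exI[of _ t]) (auto simp: abs_mult)
qed

section \<open>Congruences for the powers of 1 + \<surd>-T\<close>

text \<open>\<open>-s + \<surd>-T\<close> is minus the conjugate of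
  \<open>s + \<surd>-T\<close>.\<close>

lemma quad_uminus:
  "quad_re (- s) T k = (-1) ^ k * quad_re s T k \<and> quad_im (- s) T k = - ((-1) ^ k * quad_im s T k)"
  by (induction k) (auto simp: algebra_simps)

lemma quad_add:
  "quad_re s T (j + k) = quad_re s T j * quad_re s T k - T * (quad_im s T j * quad_im s T k) \<and>
   quad_im s T (j + k) = quad_re s T j * quad_im s T k + quad_im s T j * quad_re s T k"
proof (induction j)
  case (Suc j)
  then have IH: "quad_re s T (j + k) = quad_re s T j * quad_re s T k - T * (quad_im s T j * quad_im s T k)"
    "quad_im s T (j + k) = quad_re s T j * quad_im s T k + quad_im s T j * quad_re s T k" by simp_all
  show ?case by (simp add: IH) (simp add: algebra_simps)
qed simp

text \<open>Only the constant and linear terms of the binomial expansion survive modulo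
  \<open>T\<close>.\<close>

lemma quad_1_mod:
  "T dvd quad_re 1 T k - 1 \<and> T dvd quad_im 1 T k - int k"
proof (induction k)
  case (Suc k)
  have "quad_re 1 T (Suc k) - 1 = (quad_re 1 T k - 1) - T * quad_im 1 T k"
    "quad_im 1 T (Suc k) - int (Suc k) = (quad_re 1 T k - 1) + (quad_im 1 T k - int k)" by simp_all
  then show ?case using Suc by (metis dvd_add dvd_diff dvd_triv_left)
qed simp

text \<open>Induction on \<open>e\<close> by squaring \<open>P + W \<surd>-T\<close>: each squaring
  gains one factor 2, because \<open>T * W^2\<close> is divisible by
  \<open>4 * 4 ^ e\<close>.\<close>

lemma quad_1_mod_power2:
  assumes "4 dvd T"
  shows "2 ^ Suc e dvd quad_re 1 T (2 ^ e * r) - 1 \<and> 2 ^ Suc e dvd quad_im 1 T (2 ^ e * r) - 2 ^ e * int r"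
proof (induction e)
  case 0
  have "2 dvd T" using assms by presburger
  then have "2 dvd quad_re 1 T r - 1" "2 dvd quad_im 1 T r - int r"
    using quad_1_mod dvd_trans by blast+
  then show ?case by simp
next
  case (Suc e)
  define P W where "P = quad_re 1 T (2 ^ e * r)" and "W = quad_im 1 T (2 ^ e * r)"
  obtain T' where T: "T = 4 * T'" using assms by blast
  obtain p where p: "P = 1 + 2 ^ Suc e * p" using Suc by (metis P_def add.commute diff_add_cancel dvdE)
  obtain w where w: "W = 2 ^ e * int r + 2 ^ Suc e * w" using Suc by (metis W_def add.commute diff_add_cancel dvdE)
  have eq: "2 ^ Suc e * r = 2 ^ e * r + 2 ^ e * r" by simp
  have "quad_re 1 T (2 ^ Suc e * r) = P * P - T * (W * W)"
    unfolding eq using quad_add P_def W_def by blast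
  then have "quad_re 1 T (2 ^ Suc e * r) - 1 =
      2 ^ Suc (Suc e) * (p + 2 ^ e * p * p - T' * 2 ^ e * (int r + 2 * w) * (int r + 2 * w))"
    unfolding p w T by (simp add: algebra_simps)
  moreover have "quad_im 1 T (2 ^ Suc e * r) = P * W + W * P"
    unfolding eq using quad_add P_def W_def by blast
  then have "quad_im 1 T (2 ^ Suc e * r) - 2 ^ Suc e * int r =
      2 ^ Suc (Suc e) * (w + p * 2 ^ e * (int r + 2 * w))"
    unfolding p w by (simp add: algebra_simps)
  ultimately show ?case by (metis dvd_triv_left)
qed

text \<open>For \<open>z = k + 1\<close> the imaginary part is the sum of the two parts at
  \<open>k\<close>. With \<open>k = 2 ^ e * r\<close> and \<open>r\<close> odd, that sum is
  congruent to \<open>1 + 2 ^ e * r\<close> modulo \<open>2 ^ (e + 1)\<close>, so it is not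
  1.\<close>

lemma quad_im_1_eq_1:
  assumes "4 dvd T" "quad_im 1 T z = 1"
  shows "z = 1"
proof (rule ccontr)
  assume "z \<noteq> 1"
  moreover have "z \<noteq> 0" using assms by (cases z) auto
  ultimately obtain k where k: "z = Suc k" "k > 0" by (metis One_nat_def gr0_conv_Suc neq0_conv)
  obtain e r where er: "k = 2 ^ e * r" "odd r"
    using multiplicity_decompose'[of k 2] k(2) by (metis neq0_conv odd_one)
  have "quad_re 1 T k - 1 + (quad_im 1 T k - 2 ^ e * int r) = - (2 ^ e * int r)"
    using assms k by simp
  then have "2 ^ Suc e dvd 2 ^ e * int r"
    using quad_1_mod_power2[OF assms(1), of e r] er by (metis dvd_add dvd_minus_iff)
  then have "(2 ^ e * 2 :: int) dvd 2 ^ e * int r" by (simp add: mult.commute)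
  then show False using er by simp
qed

section \<open>Congruences and special exponential equations\<close>

lemma odd_power_mod_8:
  fixes b :: int
  assumes "odd b"
  shows "b ^ k mod 8 = (if even k then 1 else b mod 8)"
proof -
  have "b mod 8 = 1 \<or> b mod 8 = 3 \<or> b mod 8 = 5 \<or> b mod 8 = 7" using assms by presburger
  then have "(b mod 8) * (b mod 8) mod 8 = 1" by auto
  then have sq: "b * b mod 8 = 1" by (simp add: mod_mult_eq)
  have ev: "b ^ (2 * j) mod 8 = 1" for j
  proof (induction j)
    case (Suc j)
    have "b ^ (2 * Suc j) mod 8 = (b * b mod 8) * (b ^ (2 * j) mod 8) mod 8"
      by (simp add: mod_mult_eq mult.assoc)
    then show ?case using Suc sq by simp
  qed simp
  show ?thesis
  proof (cases "even k")
    case False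
    then obtain j where "k = 2 * j + 1" by (rule oddE)
    then have "b ^ k mod 8 = b * (b ^ (2 * j) mod 8) mod 8" by (simp add: mod_mult_right_eq)
    then show ?thesis using ev False by simp
  qed (use ev in \<open>auto elim!: evenE\<close>)
qed

lemma odd_power_mod_4:
  fixes b :: int
  assumes "odd b"
  shows "b ^ k mod 4 = (if even k then 1 else b mod 4)"
proof -
  have "b ^ k mod 4 = (b ^ k mod 8) mod 4" "b mod 4 = (b mod 8) mod 4"
    by (simp_all add: mod_mod_cancel)
  then show ?thesis using odd_power_mod_8[OF assms, of k] by simp
qed

lemma plus_1_power_cong: "[(N + 1) ^ k = 1] (mod N)" for N :: int
  using cong_pow[of "N + 1" 1 N k] by (simp add: cong_iff_dvd_diff)

lemma minus_1_power_cong: "[(N - 1) ^ k = (-1) ^ k] (mod N)" for N :: int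
  by (rule cong_pow) (simp add: cong_iff_dvd_diff)

text \<open>Reciprocity exchanges \<open>d\<close> and \<open>N - 1\<close>, and
  \<open>N - 1\<close> is -1 modulo \<open>d\<close>. The odd part of \<open>n\<close> is later
  evaluated this way.\<close>

lemma jacobi_divisor_minus_1:
  assumes "odd d" "d > 0" "d dvd N" "even N" "N > 0"
  shows "jacobi d (N - 1) = qr_sign d (N - 1) * jacobi (-1) d"
proof -
  have "coprime N (N - 1)" by (metis coprime_commute coprime_diff_one_left)
  then have "coprime d (N - 1)" using assms(3) coprime_divisors dvd_refl by blast
  then have "jacobi d (N - 1) = qr_sign d (N - 1) * jacobi (N - 1) d"
    using assms by (intro jacobi_reciprocity) auto
  moreover have "[N - 1 = -1] (mod d)" using assms by (simp add: cong_iff_dvd_diff)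
  ultimately show ?thesis using jacobi_cong by metis
qed

lemma jacobi_divisor_plus_1:
  assumes "odd d" "d > 0" "d dvd N" "even N" "N > 0"
  shows "jacobi d (N + 1) = qr_sign d (N + 1)"
proof -
  have "coprime N (N + 1)" by (simp add: coprime_add_one_right)
  then have "coprime d (N + 1)" using assms(3) coprime_divisors dvd_refl by blast
  then have "jacobi d (N + 1) = qr_sign d (N + 1) * jacobi (N + 1) d"
    using assms by (intro jacobi_reciprocity) auto
  moreover have "[N + 1 = 1] (mod d)" using assms by (simp add: cong_iff_dvd_diff)
  then have "jacobi (N + 1) d = 1" using jacobi_cong jacobi_1_left assms by metis
  ultimately show ?thesis by simp
qed

lemma pos_int_odd_part:
  fixes n :: int
  assumes "n > 0"
  obtains k d where "n = 2 ^ k * d" "odd d" "d > 0" "d dvd n"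
proof -
  have "n \<noteq> 0" "\<not> is_unit (2 :: int)" using assms by simp_all
  then obtain d where d: "n = 2 ^ multiplicity 2 n * d" "odd d"
    using multiplicity_decompose' by metis
  then have "d > 0" using assms by (metis zero_less_mult_iff zero_less_power zero_less_numeral less_asym)
  then show thesis using that d by (metis dvd_triv_right)
qed

lemma dvd_power_2_int:
  fixes d :: int
  assumes "d dvd 2 ^ k" "d > 0"
  obtains i where "i \<le> k" "d = 2 ^ i"
proof -
  have "prime (2 :: int)" by simp
  from divides_primepow[OF this assms(1)] obtain i where "i \<le> k" "normalize d = 2 ^ i" by blast
  then show thesis using that assms(2) by simp
qed

lemma coprime_if_cong_2:
  fixes w d :: int
  assumes "odd d" "d dvd w - 2 \<or> d dvd w + 2"
  shows "coprime w d"
proof (rule coprimeI)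
  fix g assume g: "g dvd w" "g dvd d"
  then have "g dvd 2"
    using assms(2) by (metis dvd_trans dvd_diff_right_iff dvd_add_right_iff)
  moreover have "coprime g 2" using g assms(1) by (metis coprime_right_2_iff_odd dvd_trans)
  ultimately show "is_unit g" by (meson coprime_common_divisor dvd_refl)
qed

section \<open>Reduction of exponents and two exponential equations\<close>

lemma power_cong_power_mod:
  fixes b M :: int
  assumes "[b ^ m = 1] (mod M)"
  shows "[b ^ k = b ^ (k mod m)] (mod M)"
proof -
  have "b ^ k = (b ^ m) ^ (k div m) * b ^ (k mod m)"
    by (metis mult_div_mod_eq power_add power_mult)
  moreover have "[(b ^ m) ^ (k div m) * b ^ (k mod m) = 1 ^ (k div m) * b ^ (k mod m)] (mod M)"
    using assms by (intro cong_mult cong_pow) auto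
  ultimately show ?thesis by simp
qed

text \<open>This is the case \<open>N = 4\<close>, \<open>y = 1\<close>. If \<open>x\<close> is at
  least 3, the equation modulo 125 restricts \<open>z\<close> modulo 25, and modulo 601 no residues
  of \<open>x\<close> and \<open>z\<close> are left.\<close>

lemma five_power_plus_2_eq_three_power:
  assumes "(5 :: int) ^ x + 2 = 3 ^ z" "x > 0"
  shows "x = 2 \<and> z = 3"
proof -
  have le2: "x \<le> 2"
  proof (rule ccontr)
    assume "\<not> x \<le> 2"
    then obtain j where "x = j + 3" by (metis add.commute le_add_diff_inverse not_less_eq_eq numeral_2_eq_2 numeral_3_eq_3)
    then have "(3 :: int) ^ z = 2 + 125 * 5 ^ j" using assms(1) by (simp add: power_add)
    then have z125: "(3 :: int) ^ z mod 125 = 2" by simp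
    \<comment> \<open>Since 81 to the power 25 is 1 modulo 125, passing to fourth powers leaves only
      25 exponents to test.\<close>
    have "(81 :: int) ^ z = (3 ^ z) ^ 4" by (simp flip: power_mult add: mult.commute[of z]) (simp add: power_mult)
    then have "(81 :: int) ^ z mod 125 = 16" using z125 power_mod[of "3 ^ z" "125 :: int" 4] by simp
    moreover have "[(81 :: int) ^ z = 81 ^ (z mod 25)] (mod 125)"
      by (rule power_cong_power_mod) (simp add: cong_def)
    ultimately have "(81 :: int) ^ (z mod 25) mod 125 = 16" by (simp add: cong_def)
    moreover have "\<forall>r \<in> {..<25}. (81 :: int) ^ r mod 125 = 16 \<longrightarrow> r = 18"
      by (simp add: lessThan_nat_numeral)
    ultimately have "z mod 25 = 18" by simp
    moreover have "z mod 75 mod 25 = z mod 25" by (simp add: mod_mod_cancel)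
    moreover have "z mod 75 = 25 * (z mod 75 div 25) + z mod 75 mod 25" by simp
    moreover have "z mod 75 div 25 < 3" by (simp add: less_mult_imp_div_less)
    then have "z mod 75 div 25 = 0 \<or> z mod 75 div 25 = 1 \<or> z mod 75 div 25 = 2" by linarith
    ultimately have z75: "z mod 75 = 18 \<or> z mod 75 = 43 \<or> z mod 75 = 68"
      by (elim disjE) linarith+
    \<comment> \<open>Modulo 601 both \<open>3 ^ 75\<close> and \<open>5 ^ 12\<close> are 1, so the
      three residues of \<open>z\<close> modulo 75 meet only twelve of \<open>x\<close>.\<close>
    have 3: "[(3 :: int) ^ z = 3 ^ (z mod 75)] (mod 601)"
      by (rule power_cong_power_mod) (simp add: cong_def)
    have "[(5 :: int) ^ x = 5 ^ (x mod 12)] (mod 601)"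
      by (rule power_cong_power_mod) (simp add: cong_def)
    then have "[(5 :: int) ^ x + 2 = 5 ^ (x mod 12) + 2] (mod 601)" by (intro cong_add) auto
    then have "(5 ^ (x mod 12) + 2) mod 601 = (3 :: int) ^ (z mod 75) mod 601"
      using 3 assms(1) by (simp add: cong_def)
    moreover have "\<forall>i \<in> {..<12}. (5 ^ i + 2) mod 601 \<noteq> (3 :: int) ^ 18 mod 601 \<and>
        (5 ^ i + 2) mod 601 \<noteq> (3 :: int) ^ 43 mod 601 \<and> (5 ^ i + 2) mod 601 \<noteq> (3 :: int) ^ 68 mod 601"
      by (simp add: lessThan_nat_numeral)
    moreover have "x mod 12 \<in> {..<12}" by simp
    ultimately show False using z75 by metis
  qed
  have "x \<noteq> 1"
  proof
    assume "x = 1"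
    then have eq: "(3 :: int) ^ z = 7" using assms by simp
    then have "z > 0" by (intro gr0I) auto
    then have "(3 :: int) dvd 3 ^ z" by (simp add: dvd_power)
    then show False using eq by simp
  qed
  then have x: "x = 2" using le2 assms(2) by linarith
  then have "(3 :: int) ^ z = 3 ^ 3" using assms by simp
  then have "z = 3" by (subst (asm) power_inject_exp) simp_all
  then show ?thesis using x by simp
qed

text \<open>For even \<open>k\<close> two positive squares would differ by 1. For odd
  \<open>k\<close> the geometric sum in \<open>d ^ k - 1\<close> has an odd number of odd terms, so
  it would be an odd divisor greater than 1 of a power of 2.\<close>

lemma odd_power_neq_square_plus_1:
  fixes d :: int
  assumes "d \<ge> 3" "odd d" "k \<ge> 2"
  shows "d ^ k \<noteq> 4 ^ j + 1"
proof
  assume eq: "d ^ k = 4 ^ j + 1"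
  show False
  proof (cases "even k")
    case True
    then obtain i where "k = 2 * i" by (rule evenE)
    then have "(d ^ i)\<^sup>2 = (2 ^ j)\<^sup>2 + 1" using eq by (simp flip: power_mult add: mult.commute[of _ 2]) (simp add: power_mult)
    then have "(d ^ i - 2 ^ j) * (d ^ i + 2 ^ j) = 1" by (simp add: algebra_simps power2_eq_square)
    moreover have "d ^ i + 2 ^ j > 1" using assms by (smt (verit) zero_less_power one_le_power)
    ultimately show False by (metis abs_of_pos less_trans order_less_irrefl zero_less_one zmult_eq_1_iff minus_less_iff neg_less_0_iff_less)
  next
    case False
    have par: "odd (\<Sum>i<m. d ^ i) \<longleftrightarrow> odd m" for m
      using assms(2) by (induction m) auto
    have "4 ^ j = (d - 1) * (\<Sum>i<k. d ^ i)" using eq power_diff_1_eq[of d k] by simp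
    then have "(\<Sum>i<k. d ^ i) dvd 2 ^ (2 * j)" by (simp add: power_mult)
    moreover have "coprime (\<Sum>i<k. d ^ i) (2 ^ (2 * j))" using par[of k] False by simp
    ultimately have "is_unit (\<Sum>i<k. d ^ i)" using coprime_absorb_left by metis
    moreover have "(\<Sum>i<k. d ^ i) \<ge> (\<Sum>i<2. d ^ i)" using assms by (intro sum_mono2) auto
    then have "(\<Sum>i<k. d ^ i) \<ge> 1 + d" by (simp add: numeral_2_eq_2)
    ultimately show False using assms by auto
  qed
qed

lemma mod_8_eq_2_or_6:
  fixes N :: int
  assumes "N mod 4 = 2"
  shows "N mod 8 = 2 \<or> N mod 8 = 6"
proof -
  define k where "k = N div 4"
  have N: "N = 4 * k + 2" using assms by (metis k_def mult_div_mod_eq)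
  show ?thesis
  proof (cases "even k")
    case True
    then obtain j where "k = 2 * j" by (rule evenE)
    then show ?thesis using N by simp
  next
    case False
    then obtain j where "k = 2 * j + 1" by (rule oddE)
    then show ?thesis using N by simp
  qed
qed

lemma three_power_mod_16_eq_1:
  fixes X :: nat
  assumes "(3 :: int) ^ X mod 16 = 1"
  shows "X mod 4 = 0"
proof -
  have "[(3 :: int) ^ X = 3 ^ (X mod 4)] (mod 16)"
    by (rule power_cong_power_mod) (simp add: cong_def)
  then have "(3 :: int) ^ (X mod 4) mod 16 = 1" using assms by (simp add: cong_def)
  moreover have "X mod 4 < 4" by simp
  then have "X mod 4 = 0 \<or> X mod 4 = 1 \<or> X mod 4 = 2 \<or> X mod 4 = 3" by linarith
  ultimately show ?thesis by (elim disjE) simp_all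
qed

lemma three_power_mod_16_neq_15: "(3 :: int) ^ X mod 16 \<noteq> 15"
proof -
  have "[(3 :: int) ^ X = 3 ^ (X mod 4)] (mod 16)"
    by (rule power_cong_power_mod) (simp add: cong_def)
  moreover have "X mod 4 < 4" by simp
  then have "X mod 4 = 0 \<or> X mod 4 = 1 \<or> X mod 4 = 2 \<or> X mod 4 = 3" by linarith
  then have "(3 :: int) ^ (X mod 4) mod 16 \<noteq> 15" by (elim disjE) simp_all
  ultimately show ?thesis by (simp add: cong_def)
qed

section \<open>The equation\<close>

locale shuffled_equation =
  fixes N n a :: int and x y z :: nat
  assumes a: "a \<ge> 2" and n: "n \<ge> 2" "even n" and N: "N = a * n"
    and pos: "x > 0" "y > 0" "z > 0"
    and eq: "(N + 1) ^ x + n ^ y = (N - 1) ^ z"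
begin

lemma even_N: "even N" using N n by simp

lemma N_ge: "N \<ge> 2 * n" "N \<ge> 4"
proof -
  show "N \<ge> 2 * n" unfolding N using a n by (intro mult_right_mono) auto
  then show "N \<ge> 4" using n by linarith
qed

lemma N_dvd: "N dvd n ^ y + 1 - (-1) ^ z"
proof -
  have "N dvd ((N - 1) ^ z - (-1) ^ z) - ((N + 1) ^ x - 1)"
    using plus_1_power_cong[of N x] minus_1_power_cong[of N z]
    by (intro dvd_diff[of N "(N - 1) ^ z - (-1) ^ z" "(N + 1) ^ x - 1"]) (simp_all add: cong_iff_dvd_diff)
  moreover have "((N - 1) ^ z - (-1) ^ z) - ((N + 1) ^ x - 1) = n ^ y + 1 - (-1) ^ z"
    using eq by linarith
  ultimately show ?thesis by simp
qed

lemma N_dvd_even: "even z \<Longrightarrow> N dvd n ^ y"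
  using N_dvd by simp

lemma y_ge_2: "even z \<Longrightarrow> y \<ge> 2"
proof (rule ccontr)
  assume "even z" "\<not> y \<ge> 2"
  then have "y = 1" using pos by simp
  then have "a * n dvd n" using N_dvd_even \<open>even z\<close> N by simp
  then have "a * n \<le> n" using n by (intro zdvd_imp_le) auto
  then show False using N_ge n N by linarith
qed

lemma n_power_mod_4: "y \<ge> 2 \<Longrightarrow> n ^ y mod 4 = 0"
proof -
  assume "y \<ge> 2"
  then have "2 ^ 2 dvd n ^ y" using n by (intro dvd_power_le) auto
  then show ?thesis by simp
qed

lemma n_power_mod_8: "y \<ge> 3 \<Longrightarrow> n ^ y mod 8 = 0"
proof -
  assume "y \<ge> 3"
  then have "2 ^ 3 dvd n ^ y" using n by (intro dvd_power_le) auto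
  then show ?thesis by simp
qed

section \<open>Jacobi symbols modulo N - 1 and N + 1\<close>

lemma jacobi_minus: "jacobi n (N - 1) ^ y = jacobi (-1) (N - 1) * jacobi 2 (N - 1) ^ x"
proof -
  have c: "odd (N - 1)" "N - 1 > 0" using even_N N_ge by auto
  \<comment> \<open>Modulo \<open>N - 1\<close> the equation reads
    \<open>2 ^ x + n ^ y = 0\<close>.\<close>
  have "[(N + 1) ^ x = 2 ^ x] (mod (N - 1))" by (rule cong_pow) (simp add: cong_iff_dvd_diff)
  moreover have "N - 1 dvd (N - 1) ^ z" using pos by (simp add: dvd_power)
  ultimately have "N - 1 dvd (N - 1) ^ z - ((N + 1) ^ x - 2 ^ x)"
    by (simp add: cong_iff_dvd_diff dvd_diff)
  moreover have "(N - 1) ^ z - ((N + 1) ^ x - 2 ^ x) = n ^ y - (-1) * 2 ^ x" using eq by simp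
  ultimately have "[n ^ y = (-1) * 2 ^ x] (mod (N - 1))" by (simp only: cong_iff_dvd_diff)
  then have "jacobi (n ^ y) (N - 1) = jacobi ((-1) * 2 ^ x) (N - 1)" by (rule jacobi_cong)
  then show ?thesis using jacobi_mult_left[OF c] jacobi_power_left[OF c] by metis
qed

lemma jacobi_plus:
  "jacobi n (N + 1) ^ y = (jacobi (-1) (N + 1) * jacobi 2 (N + 1)) ^ z"
proof -
  have c: "odd (N + 1)" "N + 1 > 0" using even_N N_ge by auto
  \<comment> \<open>Modulo \<open>N + 1\<close> the equation reads
    \<open>n ^ y = (-2) ^ z\<close>.\<close>
  have "[(N - 1) ^ z = ((-1) * 2) ^ z] (mod (N + 1))"
    by (rule cong_pow) (simp add: cong_iff_dvd_diff add.commute)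
  moreover have "N + 1 dvd (N + 1) ^ x" using pos by (simp add: dvd_power)
  ultimately have "N + 1 dvd ((N - 1) ^ z - ((-1) * 2) ^ z) - (N + 1) ^ x"
    by (simp only: cong_iff_dvd_diff dvd_diff)
  moreover have "((N - 1) ^ z - ((-1) * 2) ^ z) - (N + 1) ^ x = n ^ y - ((-1) * 2) ^ z" using eq by simp
  ultimately have "[n ^ y = ((-1) * 2) ^ z] (mod (N + 1))" by (simp only: cong_iff_dvd_diff)
  then have "jacobi (n ^ y) (N + 1) = jacobi (((-1) * 2) ^ z) (N + 1)" by (rule jacobi_cong)
  then show ?thesis using jacobi_mult_left[OF c] jacobi_power_left[OF c] by metis
qed

text \<open>The odd part of \<open>n\<close> has symbol 1 for both moduli, so only the power
  \<open>2 ^ k\<close> in \<open>n\<close> contributes, with the same \<open>k\<close> on both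
  sides.\<close>

lemma jacobi_n:
  assumes "N mod 4 = 0"
  obtains k where "jacobi n (N - 1) = jacobi 2 (N - 1) ^ k" "jacobi n (N + 1) = jacobi 2 (N + 1) ^ k"
proof -
  obtain k d where d: "n = 2 ^ k * d" "odd d" "d > 0" "d dvd n" using pos_int_odd_part n by (metis less_le_trans zero_less_numeral)
  have dN: "d dvd N" using d N by simp
  have m: "(N - 1) mod 4 = 3" "(N + 1) mod 4 = 1" using assms by presburger+
  have "jacobi d (N - 1) = 1"
    using jacobi_divisor_minus_1[OF d(2,3) dN even_N] jacobi_minus_1[OF d(2,3)] odd_mod_4[OF d(2)] m N_ge
    by (auto simp: qr_sign_def)
  moreover have "jacobi d (N + 1) = 1"
    using jacobi_divisor_plus_1[OF d(2,3) dN even_N] m N_ge by (simp add: qr_sign_def)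
  moreover have "odd (N - 1)" "N - 1 > 0" "odd (N + 1)" "N + 1 > 0" using even_N N_ge by auto
  ultimately show thesis using that[of k] d(1) by (simp add: jacobi_mult_left jacobi_power_left)
qed

text \<open>Modulo \<open>N - 1\<close>, which would be 7 modulo 8, the symbols of 2 and of
  \<open>n\<close> are 1 while that of -1 is -1.\<close>

lemma N_mod_8_neq_0: "N mod 8 \<noteq> 0"
proof
  assume N8: "N mod 8 = 0"
  then have "N mod 4 = 0" "(N - 1) mod 4 = 3" "(N - 1) mod 8 = 7" by presburger+
  moreover have "odd (N - 1)" "N - 1 > 0" using even_N N_ge by auto
  ultimately have "jacobi 2 (N - 1) = 1" "jacobi (-1) (N - 1) = -1"
    by (simp_all add: jacobi_2 jacobi_minus_1)
  moreover obtain k where "jacobi n (N - 1) = jacobi 2 (N - 1) ^ k" using jacobi_n \<open>N mod 4 = 0\<close> by metis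
  ultimately show False using jacobi_minus by simp
qed

text \<open>The modulus \<open>N + 1\<close> gives \<open>(-1) ^ (k * y) = 1\<close>, and the
  modulus \<open>N - 1\<close> equates the same sign with \<open>-(-1) ^ x\<close>.\<close>

lemma x_odd:
  assumes N8: "N mod 8 = 4" and "even z"
  shows "odd x"
proof -
  have m: "N mod 4 = 0" "(N - 1) mod 4 = 3" "(N - 1) mod 8 = 3" "(N + 1) mod 4 = 1" "(N + 1) mod 8 = 5"
    using N8 by presburger+
  moreover have c: "odd (N - 1)" "N - 1 > 0" "odd (N + 1)" "N + 1 > 0" using even_N N_ge by auto
  ultimately have j: "jacobi 2 (N - 1) = -1" "jacobi (-1) (N - 1) = -1"
      "jacobi 2 (N + 1) = -1" "jacobi (-1) (N + 1) = 1"
    by (simp_all add: jacobi_2 jacobi_minus_1)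
  obtain k where k: "jacobi n (N - 1) = (-1) ^ k" "jacobi n (N + 1) = (-1) ^ k"
    using jacobi_n m(1) j by metis
  have "((-1) ^ k) ^ y = (-1 :: int) ^ z" using jacobi_plus k j by simp
  then have "((-1) ^ k) ^ y = (1 :: int)" using \<open>even z\<close> by simp
  then have "- 1 * (- 1) ^ x = (1 :: int)" using jacobi_minus k j by metis
  then show ?thesis by (cases "even x") auto
qed

text \<open>An odd \<open>y\<close> would leave the signs unchanged. Then the modulus
  \<open>N - 1\<close> gives \<open>d mod 4 = 1\<close>, which makes the symbol of \<open>n\<close>
  modulo \<open>N + 1\<close> equal to -1, although it should be 1.\<close>

lemma y_even:
  assumes N8: "N mod 8 = 2" and z: "even z" and d: "n = 2 * d" "odd d"
  shows "even y"
proof (rule ccontr)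
  assume y: "odd y"
  have d': "d > 0" "d dvd N" using n d N by auto
  have m: "(N - 1) mod 4 = 1" "(N - 1) mod 8 = 1" "(N + 1) mod 4 = 3" "(N + 1) mod 8 = 3"
    using N8 by presburger+
  have c: "odd (N - 1)" "N - 1 > 0" "odd (N + 1)" "N + 1 > 0" using even_N N_ge by auto
  have j: "jacobi 2 (N - 1) = 1" "jacobi (-1) (N - 1) = 1"
      "jacobi 2 (N + 1) = -1" "jacobi (-1) (N + 1) = -1"
    using m c by (simp_all add: jacobi_2 jacobi_minus_1)
  have pm: "i ^ y = i" if "i = 1 \<or> i = -1" for i :: int using that y by auto
  have "jacobi d (N - 1) = jacobi (-1) d"
    using jacobi_divisor_minus_1[OF d(2) d' even_N] m N_ge by (simp add: qr_sign_def)
  then have "jacobi n (N - 1) = jacobi (-1) d" using d(1) j c by (simp add: jacobi_mult_left)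
  then have "jacobi (-1) d ^ y = 1" using jacobi_minus j by simp
  then have "jacobi (-1) d = 1" using pm jacobi_minus_1[OF d(2) d'(1)] by (auto split: if_splits)
  then have "d mod 4 = 1" using jacobi_minus_1[OF d(2) d'(1)] by (auto split: if_splits)
  then have "jacobi d (N + 1) = 1"
    using jacobi_divisor_plus_1[OF d(2) d' even_N] N_ge by (simp add: qr_sign_def)
  then have "jacobi n (N + 1) = -1" using d(1) j c by (simp add: jacobi_mult_left)
  then show False using jacobi_plus j z pm[of "-1"] by simp
qed

lemma y_even_2:
  assumes N8: "N mod 8 = 2" and "n = 2"
  shows "even y"
proof -
  have m: "(N + 1) mod 4 = 3" "(N + 1) mod 8 = 3"
    using N8 by presburger+
  have c: "odd (N + 1)" "N + 1 > 0" using even_N N_ge by auto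
  have "jacobi 2 (N + 1) = -1" "jacobi (-1) (N + 1) = -1"
    using m c by (simp_all add: jacobi_2 jacobi_minus_1)
  then have "(-1) ^ y = (1 :: int)" using jacobi_plus \<open>n = 2\<close> by simp
  then show ?thesis by (cases "even y") auto
qed

section \<open>Solutions with even z\<close>

lemma N_mod_8_eq_4:
  assumes z: "even z" and N8: "N mod 8 = 4"
  shows "a = 2 \<and> n = 2 \<and> x = 1 \<and> y = 2 \<and> z = 2"
proof -
  have x: "odd x" using x_odd N8 z by simp
  have "(N + 1) mod 8 = 5" using N8 by presburger
  then have "(N + 1) ^ x mod 8 = 5" "(N - 1) ^ z mod 8 = 1"
    using odd_power_mod_8[of "N + 1" x] odd_power_mod_8[of "N - 1" z] even_N x z by simp_all
  \<comment> \<open>Modulo 8 the equation is \<open>5 + n ^ y = 1\<close>, so 8 does not divide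
    \<open>n ^ y\<close>.\<close>
  moreover have "q mod 8 \<noteq> 0" if "p mod 8 = 5" "r mod 8 = 1" "p + q = r" for p q r :: int
    using that by presburger
  ultimately have "n ^ y mod 8 \<noteq> 0" using eq by metis
  then have y: "y = 2" using n_power_mod_8 y_ge_2[OF z] by (cases "y \<ge> 3") auto
  obtain Z where Z: "z = 2 * Z" using z by (rule evenE)
  define u where "u = (N - 1) ^ Z"
  have u: "u\<^sup>2 = (N + 1) ^ x + n\<^sup>2" using eq y Z by (simp add: u_def power_mult mult.commute flip: power_mult)
  have u0: "u > 0" using N_ge by (simp add: u_def)
  have "u\<^sup>2 > n\<^sup>2" using u N_ge by simp
  then have un: "u > n" using u0 n by (simp add: power2_less_imp_less)
  have fac: "(u - n) * (u + n) = (N + 1) ^ x" using u by (simp add: algebra_simps power2_eq_square)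
  have x1: "x = 1"
  proof (rule ccontr)
    assume "x \<noteq> 1"
    then have x3: "x \<ge> 3" using x by presburger
    \<comment> \<open>Coprimality makes both factors \<open>x\<close>-th powers,
      \<open>P ^ x\<close> and \<open>Q ^ x\<close> with \<open>P * Q = N + 1\<close>.\<close>
    have "coprime (u - n) (u + n)"
    proof (rule coprimeI)
      fix g assume g: "g dvd u - n" "g dvd u + n"
      then have "g dvd (u + n) - (u - n)" by (rule dvd_diff[rotated])
      then have "g dvd 2 * n" by simp
      moreover have "g dvd (N + 1) ^ x" using g fac by (metis dvd_mult2)
      moreover have "coprime (2 * n) ((N + 1) ^ x)"
      proof -
        have "coprime (N + 1) N" by simp
        then have "coprime (N + 1) n" using N by (metis coprime_mult_right_iff)
        moreover have "coprime (N + 1) 2" using even_N by simp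
        ultimately show ?thesis by (simp add: coprime_commute)
      qed
      ultimately show "is_unit g" using coprime_common_divisor by blast
    qed
    then have cop: "coprime (nat (u - n)) (nat (u + n))"
      using un u0 n by (simp add: coprime_int_iff[symmetric])
    have "nat (u - n) * nat (u + n) = nat (N + 1) ^ x"
      using fac un u0 n N_ge by (simp add: nat_mult_distrib[symmetric] nat_power_eq)
    then have pw: "is_nth_power x (nat (u - n) * nat (u + n))" by simp
    obtain p q where pq: "nat (u - n) = p ^ x" "nat (u + n) = q ^ x"
      using is_nth_power_mult_coprime_natD[OF cop pw] un u0 n by (auto elim!: is_nth_powerE)
    define P Q where "P = int p" and "Q = int q"
    have PQ: "u - n = P ^ x" "u + n = Q ^ x"
      using pq un u0 n unfolding P_def Q_def by (metis int_nat_eq of_nat_power less_imp_le diff_gt_0_iff_gt add_pos_pos less_le_trans zero_less_numeral)+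
    have "P \<ge> 0" "Q \<ge> 0" by (simp_all add: P_def Q_def)
    have "P * Q = N + 1"
    proof -
      have "(P * Q) ^ x = (N + 1) ^ x" using fac PQ by (simp add: power_mult_distrib)
      then show ?thesis using \<open>P \<ge> 0\<close> \<open>Q \<ge> 0\<close> N_ge pos(1) by (intro power_eq_imp_eq_base[of "P * Q" x "N + 1"]) auto
    qed
    have "P ^ x < Q ^ x" using PQ n by linarith
    then have "P < Q" using \<open>Q \<ge> 0\<close> by (rule power_less_imp_less_base)
    \<comment> \<open>For \<open>x\<close> at least 3, the difference of the powers is at least
      \<open>Q^2\<close>, hence at least \<open>P * Q = N + 1\<close>, which exceeds
      \<open>2 * n\<close>.\<close>
    have "2 * n = Q ^ x - P ^ x" using PQ by linarith
    also have "\<dots> = Q ^ (x - 1) * Q - P ^ (x - 1) * P"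
      using pos(1) by (simp only: power_minus_mult)
    also have "\<dots> \<ge> Q ^ (x - 1) * Q - Q ^ (x - 1) * P"
      using \<open>P < Q\<close> \<open>P \<ge> 0\<close> by (intro diff_left_mono mult_right_mono power_mono) auto
    finally have "2 * n \<ge> Q ^ (x - 1) * (Q - P)" by (simp add: algebra_simps)
    moreover have "Q ^ (x - 1) * (Q - P) \<ge> Q ^ (x - 1) * 1"
      using \<open>P < Q\<close> \<open>Q \<ge> 0\<close> by (intro mult_left_mono) auto
    moreover have "Q ^ (x - 1) \<ge> Q ^ 2"
      using x3 \<open>P < Q\<close> \<open>P \<ge> 0\<close> by (intro power_increasing) auto
    moreover have "Q ^ 2 \<ge> P * Q" using \<open>P < Q\<close> \<open>Q \<ge> 0\<close> unfolding power2_eq_square by (intro mult_right_mono) auto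
    ultimately show False using \<open>P * Q = N + 1\<close> N_ge by linarith
  qed
  \<comment> \<open>With \<open>x = 1\<close> and \<open>y = 2\<close> the left side grows only
    quadratically in \<open>M = N - 1\<close>, too slowly for \<open>M ^ 4\<close>.\<close>
  have Z1: "Z = 1"
  proof (rule ccontr)
    assume "Z \<noteq> 1"
    then have "z \<ge> 4" using pos Z by linarith
    define M where "M = N - 1"
    have M: "M \<ge> 3" using N_ge M_def by simp
    have "M ^ z \<ge> M ^ 4" using \<open>z \<ge> 4\<close> M by (intro power_increasing) auto
    moreover have "M ^ z = N + 1 + n\<^sup>2" using eq x1 y by (simp add: M_def)
    moreover have "n\<^sup>2 \<le> N\<^sup>2" using N_ge n by (intro power_mono) auto
    moreover have "N = M + 1" by (simp add: M_def)
    ultimately have "M ^ 4 \<le> M\<^sup>2 + 3 * M + 3" by (simp add: power2_eq_square algebra_simps)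
    moreover have "M ^ 4 = M\<^sup>2 * M\<^sup>2" by (simp flip: power_add)
    moreover have "M\<^sup>2 \<ge> 3 * M" using M by (simp add: power2_eq_square mult_right_mono)
    moreover have "M\<^sup>2 * M\<^sup>2 \<ge> 9 * M\<^sup>2"
      using M calculation(3) by (intro mult_right_mono) auto
    ultimately show False using M by linarith
  qed
  have "N + 1 + n\<^sup>2 = (N - 1)\<^sup>2" using eq x1 y Z Z1 by simp
  then have "n * n = n * (a * (N - 3))" unfolding N by (simp add: algebra_simps power2_eq_square)
  then have n_eq: "n = a * (N - 3)" using n by simp
  have "a = 2"
  proof (rule ccontr)
    assume "a \<noteq> 2"
    then have a3: "a \<ge> 3" using a by simp
    have "N \<ge> 3 * n" unfolding N using a3 n by (intro mult_right_mono) auto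
    moreover have "n \<ge> 3 * (N - 3)" using n_eq mult_right_mono[of 3 a "N - 3"] a3 N_ge by simp
    moreover have False if "N \<ge> 3 * n" "n \<ge> 3 * (N - 3)" "N \<ge> 4" for N n :: int
      using that by simp
    ultimately show False using N_ge by blast
  qed
  moreover have "n = 2"
  proof -
    have "n = 2 * (2 * n - 3)" using n_eq unfolding N \<open>a = 2\<close> .
    then show ?thesis by simp
  qed
  ultimately show ?thesis using x1 y Z Z1 by simp
qed

text \<open>Here \<open>a\<close> and \<open>d = n/2\<close> are odd. The residues of
  \<open>u\<close> and \<open>v\<close> modulo \<open>d\<close> show which factor of
  \<open>u^2 - v^2 = n ^ y\<close> is coprime to \<open>d\<close> and so a power of 2; a second
  difference of squares then determines \<open>d\<close>.\<close>

lemma N_mod_4_neq_2: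
  assumes z: "even z" and N4: "N mod 4 = 2"
  shows False
proof -
  obtain d where d: "n = 2 * d" using n by blast
  have "odd w" if "(2 * w) mod 4 = 2" for w :: int using that by presburger
  moreover have "(2 * (a * d)) mod 4 = 2" using N4 unfolding N d by (simp add: mult.left_commute)
  ultimately have "odd (a * d)" by blast
  then have ad: "odd a" "odd d" by simp_all
  have a3: "a \<ge> 3" using a ad by presburger
  have y2: "y \<ge> 2" using y_ge_2 z by simp
  have d3: "d \<ge> 3"
  proof (rule ccontr)
    assume "\<not> d \<ge> 3"
    then have "d = 1" using d n ad by presburger
    then have "a * 2 dvd 2 ^ y" using N_dvd_even[OF z] d N by (simp add: mult.commute)
    then have "a dvd 2 ^ y" using dvd_mult_left by blast
    moreover have "coprime a (2 ^ y)" using ad by simp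
    ultimately have "is_unit a" using coprime_absorb_left by blast
    then show False using a by simp
  qed
  have N6: "N \<ge> 6"
    using N_ge d d3 by linarith
  have m4: "(N + 1) mod 4 = 3" "(N - 1) mod 4 = 1" using N4 by presburger+
  have "even x"
  proof (rule ccontr)
    assume "odd x"
    then have "(N + 1) ^ x mod 4 = 3" "(N - 1) ^ z mod 4 = 1"
      using odd_power_mod_4[of "N + 1" x] odd_power_mod_4[of "N - 1" z] even_N m4 z by simp_all
    moreover have False if "p mod 4 = 3" "q mod 4 = 0" "r mod 4 = 1" "p + q = r" for p q r :: int
      using that by presburger
    ultimately show False using eq n_power_mod_4[OF y2] by metis
  qed
  obtain X where X: "x = 2 * X" using \<open>even x\<close> by (rule evenE)
  obtain Z where Z: "z = 2 * Z" using z by (rule evenE)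
  define u v where "u = (N - 1) ^ Z" and "v = (N + 1) ^ X"
  have odd: "odd u" "odd v" using even_N by (simp_all add: u_def v_def)
  have uv0: "u > 0" "v > 0" using N_ge by (simp_all add: u_def v_def)
  have "u * u - v * v = n ^ y"
    using eq unfolding X Z u_def v_def by (simp add: mult_2 power_add)
  then have fac: "(u + v) * (u - v) = 2 ^ y * d ^ y"
    using d by (simp add: algebra_simps power_mult_distrib)
  have "(u + v) * (u - v) > 0" using fac d3 by simp
  then have uv: "u > v" using uv0 by (simp add: zero_less_mult_iff)
  have dN: "d dvd N" using d N by simp
  have v1: "N dvd v - 1" using plus_1_power_cong[of N X] by (simp add: v_def cong_iff_dvd_diff)
  have u1: "N dvd u - (-1) ^ Z" using minus_1_power_cong[of N Z] by (simp add: u_def cong_iff_dvd_diff)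
  \<comment> \<open>For even \<open>Z\<close> both \<open>u\<close> and \<open>v\<close> are 1
    modulo \<open>N\<close>, so \<open>u + v\<close> is coprime to \<open>d\<close> and divides
    \<open>2 ^ y\<close>. The cofactor \<open>u - v\<close> would then be at least
    \<open>u + v\<close>.\<close>
  have oddZ: "odd Z"
  proof
    assume "even Z"
    then have "N dvd (u - 1) + (v - 1)" using u1 v1 by (intro dvd_add) simp_all
    moreover have "(u - 1) + (v - 1) = (u + v) - 2" by simp
    ultimately have "d dvd (u + v) - 2" using dN dvd_trans by metis
    then have "coprime (u + v) d" using coprime_if_cong_2[OF ad(2)] by blast
    then have "coprime (u + v) (d ^ y)" by simp
    then have "u + v dvd 2 ^ y" using fac by (metis coprime_dvd_mult_left_iff dvd_triv_left)
    then obtain w where w: "2 ^ y = (u + v) * w" by blast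
    then have "u - v = w * d ^ y" using fac uv0 by simp
    moreover have "even (u - v)" using odd by simp
    ultimately have "even w" using ad by simp
    moreover have "w > 0" using w uv0 by (metis zero_less_mult_pos zero_less_power zero_less_numeral add_pos_pos)
    ultimately have w2: "w \<ge> 2" by presburger
    have "w * d ^ y \<ge> 1 * 2 ^ y" using w2 d3 by (intro mult_mono power_mono) auto
    then have "u - v \<ge> (u + v) * w" using \<open>u - v = w * d ^ y\<close> w by simp
    moreover have "(u + v) * w \<ge> (u + v) * 1" using w2 uv0 by (intro mult_left_mono) auto
    ultimately have "(u + v) * 1 \<le> u - v" by (rule order.trans[rotated])
    then show False using uv0 by simp
  qed
  then have "N dvd (u + 1) - (v - 1)" using u1 v1 by (intro dvd_diff[of N "u + 1" "v - 1"]) simp_all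
  moreover have "(u + 1) - (v - 1) = (u - v) + 2" by simp
  ultimately have Nuv: "N dvd (u - v) + 2" by metis
  then have "coprime (u - v) d" using coprime_if_cong_2[OF ad(2)] dN dvd_trans by blast
  then have "coprime (u - v) (d ^ y)" by simp
  then have "u - v dvd 2 ^ y" using fac by (metis coprime_dvd_mult_left_iff dvd_triv_right)
  then obtain i where i: "i \<le> y" "u - v = 2 ^ i" using dvd_power_2_int uv by (metis diff_gt_0_iff_gt)
  have "u - v \<noteq> 2"
  proof
    assume "u - v = 2"
    then have "N \<le> 4" using Nuv by (intro zdvd_imp_le) auto
    then show False using N6 by simp
  qed
  moreover have "u - v \<noteq> 1" using odd by presburger
  ultimately have i2: "i \<ge> 2" using i by (cases i; cases "i - 1") auto
  then have "2 ^ 2 dvd (2 :: int) ^ i" by (rule le_imp_power_dvd)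
  then have "4 dvd u - v" using i by simp
  have "2 ^ i * (u + v) = 2 ^ i * (2 ^ (y - i) * d ^ y)"
  proof -
    have "(2 :: int) ^ y = 2 ^ i * 2 ^ (y - i)" using i by (simp flip: power_add)
    then show ?thesis using fac i by (simp add: mult.commute)
  qed
  then have sum: "u + v = 2 ^ (y - i) * d ^ y" by simp
  \<comment> \<open>\<open>u\<close> and \<open>v\<close> are odd and 4 divides
    \<open>u - v\<close>, so \<open>u + v\<close> is even but not divisible by 4.\<close>
  have "y - i = 1"
  proof (rule ccontr)
    assume "y - i \<noteq> 1"
    then consider "y - i = 0" | "y - i \<ge> 2" by linarith
    then show False
    proof cases
      case 1
      then have "odd (u + v)" using sum ad by simp
      then show False using odd by simp
    next
      case 2
      then have "2 ^ 2 dvd (2 :: int) ^ (y - i)" by (rule le_imp_power_dvd)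
      then have "4 dvd u + v" using sum by simp
      then show False using \<open>4 dvd u - v\<close> odd by presburger
    qed
  qed
  then have y: "y = Suc i" using i by simp
  then have sum: "u + v = 2 * d ^ y" using sum by simp
  have u4: "u mod 4 = 1" using odd_power_mod_4[of "N - 1" Z] even_N m4 by (simp add: u_def)
  have "even X"
  proof (rule ccontr)
    assume "odd X"
    then have "v mod 4 = 3" using odd_power_mod_4[of "N + 1" X] even_N m4 by (simp add: v_def)
    then show False using u4 \<open>4 dvd u - v\<close> by presburger
  qed
  obtain W where W: "X = 2 * W" using \<open>even X\<close> by (rule evenE)
  define w where "w = (N + 1) ^ W"
  have vw: "v = w * w" unfolding v_def w_def W by (simp add: mult_2 power_add)
  have w0: "w > 0" "odd w" using N_ge even_N by (simp_all add: w_def)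
  have v8: "v mod 8 = 1" using odd_power_mod_8[of "N + 1" X] even_N \<open>even X\<close> by (simp add: v_def)
  have u8: "u mod 8 = (N - 1) mod 8" using odd_power_mod_8[of "N - 1" Z] even_N oddZ by (simp add: u_def)
  \<comment> \<open>Otherwise 8 does not divide \<open>u - v\<close>, so \<open>u - v = 4\<close>
    and \<open>N\<close> divides 6, contrary to \<open>N \<ge> 3 * n\<close>.\<close>
  have N8: "N mod 8 = 2"
  proof (rule ccontr)
    assume "N mod 8 \<noteq> 2"
    then have "N mod 8 = 6" using N4 mod_8_eq_2_or_6 by blast
    then have "(N - 1) mod 8 = 5" using mod_diff_left_eq[of N 8 1] by simp
    then have "\<not> 8 dvd u - v" using u8 v8 by (simp add: mod_eq_dvd_iff[symmetric])
    then have "\<not> 2 ^ 3 dvd (2 :: int) ^ i" using i by simp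
    then have "\<not> 3 \<le> i" using le_imp_power_dvd by blast
    then have "u - v = 4" using i i2 by (cases "i = 2") auto
    then have "N \<le> 6" using Nuv by (intro zdvd_imp_le) auto
    moreover have "N \<ge> 3 * n" unfolding N using a3 n by (intro mult_right_mono) auto
    ultimately show False using d d3 by simp
  qed
  have "even y" using y_even[OF N8 z d ad(2)] .
  then obtain Y where Y: "y = 2 * Y" by (rule evenE)
  have Y2: "Y \<ge> 2" using y i2 Y by linarith
  define p where "p = d ^ Y"
  have p: "odd p" "p > 0" using ad d3 by (simp_all add: p_def)
  have "d ^ y = p * p" unfolding p_def Y by (simp add: mult_2 power_add)
  \<comment> \<open>This is \<open>(u + v) - 2 * v = u - v\<close>, giving the second difference of
    squares.\<close>
  then have "2 * (p * p) - 2 * (w * w) = 2 ^ i" using sum i vw by linarith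
  moreover have "i = Suc (2 * Y - 2)" using y Y Y2 by linarith
  ultimately have pw: "(p + w) * (p - w) = 2 ^ (2 * Y - 2)" by (simp add: algebra_simps)
  then have "(p + w) * (p - w) > 0" by simp
  then have pw0: "p - w > 0" using p w0 by (simp add: zero_less_mult_iff)
  have "p - w dvd 2 ^ (2 * Y - 2)" using pw by (metis dvd_triv_right)
  then obtain j where j: "j \<le> 2 * Y - 2" "p - w = 2 ^ j" using dvd_power_2_int pw0 by metis
  have "2 ^ j * (p + w) = 2 ^ j * 2 ^ (2 * Y - 2 - j)"
    using pw j by (simp add: mult.commute flip: power_add)
  then have pw2: "p + w = 2 ^ (2 * Y - 2 - j)" by simp
  have "even (p - w)" using p w0 by simp
  then have "j \<noteq> 0" using j by (intro notI) simp
  have "j < 2 * Y - 2 - j"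
  proof -
    have "(2 :: int) ^ j < 2 ^ (2 * Y - 2 - j)" using pw2 j w0 by linarith
    then show ?thesis by simp
  qed
  \<comment> \<open>Both factors are even, but they cannot both be divisible by 4, because their sum
    is \<open>2 * p\<close> with \<open>p\<close> odd.\<close>
  have "j = 1"
  proof (rule ccontr)
    assume "j \<noteq> 1"
    then have "2 \<le> j" "2 \<le> 2 * Y - 2 - j" using \<open>j \<noteq> 0\<close> \<open>j < 2 * Y - 2 - j\<close> by linarith+
    then have "2 ^ 2 dvd p - w" "2 ^ 2 dvd p + w" unfolding j(2) pw2 by (simp_all only: le_imp_power_dvd)
    then have "4 dvd p - w" "4 dvd p + w" by simp_all
    then show False using p by presburger
  qed
  then have "2 * Y - 2 - j = Suc (2 * (Y - 2))" using \<open>j < 2 * Y - 2 - j\<close> by linarith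
  then have "p + w = 2 * 4 ^ (Y - 2)" using pw2 by (simp add: power_mult)
  moreover have "p - w = 2" using j \<open>j = 1\<close> by simp
  ultimately have "d ^ Y = 4 ^ (Y - 2) + 1" by (simp add: p_def)
  then show False using odd_power_neq_square_plus_1[OF d3 ad(2) Y2] by simp
qed

lemma even_z_solution:
  assumes "even z"
  shows "a = 2 \<and> n = 2 \<and> x = 1 \<and> y = 2 \<and> z = 2"
proof -
  have "N mod 8 = 0 \<or> N mod 8 = 4 \<or> N mod 4 = 2" using even_N by presburger
  then show ?thesis using N_mod_8_neq_0 N_mod_8_eq_4 N_mod_4_neq_2 assms by blast
qed

section \<open>Solutions with odd z\<close>

lemma N_dvd_odd: "odd z \<Longrightarrow> N dvd n ^ y + 2"
  using N_dvd by (simp add: add.commute)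

lemma odd_z_no_large_y:
  assumes z: "odd z" and n2: "n = 2" and N8: "N mod 8 = 2" and x: "even x" and y: "even y" "y \<ge> 4"
  shows False
proof -
  obtain X where X: "x = 2 * X" using x by (rule evenE)
  obtain Y where Y: "y = 2 * Y" using y(1) by (rule evenE)
  define A where "A = (N + 1) ^ X"
  have "A * A + 2 ^ Y * 2 ^ Y = (N - 1) ^ z"
    using eq unfolding X Y n2 A_def by (simp add: mult_2 power_add)
  then have sq: "A\<^sup>2 + (2 ^ Y)\<^sup>2 = (N - 1) ^ z" by (simp only: power2_eq_square)
  have A: "odd A" "A > 0" using even_N N_ge by (simp_all add: A_def)
  have "Y > 0" using y Y by simp
  then have "even ((2 :: int) ^ Y)" by simp
  moreover have "coprime (2 ^ Y) (N - 1)" using even_N by simp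
  ultimately obtain s t where st: "s\<^sup>2 + t\<^sup>2 = N - 1" "even t" "\<bar>A\<bar> = \<bar>quad_re s (t\<^sup>2) z\<bar>"
    "\<bar>2 ^ Y\<bar> = \<bar>t * quad_im s (t\<^sup>2) z\<bar>"
    using odd_even_squares_eq_power[of "N - 1" "2 ^ Y" A z] even_N N_ge A sq pos(3) by auto
  have "odd s" using st(1,2) even_N by (metis even_add even_diff even_power odd_one zero_less_numeral)
  \<comment> \<open>An odd divisor of \<open>2 ^ Y\<close> is 1 or -1, so the whole power of 2 sits
    in \<open>t\<close>.\<close>
  have "odd (quad_im s (t\<^sup>2) z)" using quad_parity(2)[of s "t\<^sup>2" z] \<open>odd s\<close> st(2) z by simp
  then have "coprime (quad_im s (t\<^sup>2) z) (2 ^ Y)" by simp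
  moreover have "quad_im s (t\<^sup>2) z dvd 2 ^ Y" using st(4) by (metis dvd_abs_iff dvd_triv_right)
  ultimately have "is_unit (quad_im s (t\<^sup>2) z)" using coprime_absorb_left by blast
  then have im: "\<bar>quad_im s (t\<^sup>2) z\<bar> = 1" by simp
  then have "\<bar>t\<bar> = 2 ^ Y" using st(4) by (simp add: abs_mult)
  then have "t\<^sup>2 = (2 ^ Y)\<^sup>2" by (metis power2_abs)
  also have "\<dots> = 2 ^ y" unfolding Y by (simp flip: power_mult add: mult.commute)
  finally have t: "t\<^sup>2 = 2 ^ y" .
  define T :: int where "T = 2 ^ y"
  \<comment> \<open>Since \<open>N = s^2 + T + 1\<close> with \<open>s\<close> nonzero, the bound
    \<open>N \<le> T + 2\<close> leaves only \<open>s^2 = 1\<close>.\<close>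
  have "N dvd T + 2" using N_dvd_odd z n2 by (simp add: T_def)
  then have "N \<le> T + 2" by (intro zdvd_imp_le) (simp_all add: T_def add_pos_pos)
  moreover have "s\<^sup>2 \<noteq> 0" using \<open>odd s\<close> by auto
  then have "s\<^sup>2 > 0" by (metis zero_less_power2 zero_eq_power2)
  ultimately have s2: "s\<^sup>2 = 1" and NT: "N = T + 2" using st(1) t T_def by linarith+
  have "s = 1 \<or> s = -1" using s2 by (simp add: power2_eq_1_iff)
  then have re1: "\<bar>quad_re 1 T z\<bar> = A" and im1: "\<bar>quad_im 1 T z\<bar> = 1"
    using st(3) im A quad_uminus[of 1 T z] unfolding t T_def[symmetric] by (auto simp: abs_mult power_abs)
  have "2 ^ 4 dvd T" unfolding T_def using y(2) by (rule le_imp_power_dvd)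
  then have T16: "16 dvd T" by simp
  then have T4: "4 dvd T" by (rule dvd_trans[rotated]) simp
  have "quad_im 1 T z \<noteq> 1"
  proof
    assume "quad_im 1 T z = 1"
    then have "z = 1" using quad_im_1_eq_1 T4 by simp
    then have "(N + 1) ^ x + n ^ y = N - 1" using eq by simp
    moreover have "(N + 1) ^ x \<ge> (N + 1) ^ 1" using pos N_ge by (intro power_increasing) auto
    moreover have "n ^ y > 0" using n by simp
    ultimately show False by simp
  qed
  then have im1: "quad_im 1 T z = -1" using im1 by linarith
  \<comment> \<open>The imaginary part is congruent to \<open>z\<close> modulo \<open>T\<close>, so
    the value -1 fixes \<open>z\<close> modulo 4.\<close>
  have "T dvd - 1 - int z" using quad_1_mod[of T z] im1 by simp
  then have "4 dvd - 1 - int z" using T4 dvd_trans by blast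
  then have z4: "z mod 4 = 3" by presburger
  \<comment> \<open>\<open>N + 1 = T + 3\<close> is 3 modulo 16, while the real part is 1 modulo 16.
    As no power of 3 is -1 modulo 16, this settles the sign and gives
    \<open>X mod 4 = 0\<close>.\<close>
  have A16: "[A = 3 ^ X] (mod 16)" unfolding A_def NT
    by (rule cong_pow) (use T16 in \<open>simp add: cong_iff_dvd_diff\<close>)
  have re16: "16 dvd quad_re 1 T z - 1" using quad_1_mod[of T z] T16 dvd_trans by blast
  have re: "quad_re 1 T z = A"
  proof (rule ccontr)
    assume "quad_re 1 T z \<noteq> A"
    then have "quad_re 1 T z = - A" using re1 by linarith
    then have "16 dvd - (A - (-1))" using re16 by (simp add: algebra_simps)
    then have "A mod 16 = (-1) mod 16" by (simp only: dvd_minus_iff mod_eq_dvd_iff)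
    then have "A mod 16 = 15" by simp
    then show False using A16 three_power_mod_16_neq_15 by (simp add: cong_def)
  qed
  then have "16 dvd A - 1" using re16 by simp
  then have "A mod 16 = 1 mod 16" by (simp only: mod_eq_dvd_iff)
  then have "A mod 16 = 1" by simp
  then have X4: "X mod 4 = 0" using A16 three_power_mod_16_eq_1 by (simp add: cong_def)
  have T5: "[T = (-1) ^ Y] (mod 5)" unfolding T_def Y power_mult
    by (rule cong_pow) (simp add: cong_def)
  show False
  proof (cases "even Y")
    case True
    then have T1: "[T = 1] (mod 5)" using T5 by simp
    \<comment> \<open>The equation modulo 5 becomes \<open>4 ^ x + 1 = 2 ^ z\<close>, that is 2 =
      3.\<close>
    have "[N + 1 = 1 + 3] (mod 5)" "[N - 1 = 1 + 1] (mod 5)"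
      unfolding NT using T1 by (simp_all add: cong_iff_dvd_diff)
    then have "[(N + 1) ^ x = 4 ^ x] (mod 5)" "[(N - 1) ^ z = 2 ^ z] (mod 5)"
      by (auto intro: cong_pow)
    moreover have "[(4 :: int) ^ x = 4 ^ (x mod 2)] (mod 5)"
      by (rule power_cong_power_mod) (simp add: cong_def)
    then have "[(4 :: int) ^ x = 1] (mod 5)" using x by simp
    moreover have "[(2 :: int) ^ z = 2 ^ (z mod 4)] (mod 5)"
      by (rule power_cong_power_mod) (simp add: cong_def)
    then have "[(2 :: int) ^ z = 3] (mod 5)" using z4 by (simp add: cong_def)
    ultimately have "[(N + 1) ^ x + T = 1 + 1] (mod 5)" "[(N - 1) ^ z = 3] (mod 5)"
      using T1 by (meson cong_add cong_trans)+
    then have "[(2 :: int) = 3] (mod 5)" using eq n2 by (simp add: cong_def T_def)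
    then show False by (simp add: cong_def)
  next
    case False
    then have T1: "[T = -1] (mod 5)" using T5 by simp
    obtain k where k: "z = Suc k" using pos(3) gr0_implies_Suc by blast
    define P W where "P = quad_re 1 T k" and "W = quad_im 1 T k"
    have "A = P - T * W" "P + W = -1" using re im1 unfolding k P_def W_def by simp_all
    then have "W = - 1 - P" by simp
    \<comment> \<open>Eliminating \<open>W\<close> exposes the factor \<open>T + 1\<close>, a
      multiple of 5. So \<open>A\<close> is -1 modulo 5, whereas \<open>2 ^ X\<close> with
      \<open>X mod 4 = 0\<close> makes it 1.\<close>
    have "A + 1 = (P + 1) * (T + 1)"
      unfolding \<open>A = P - T * W\<close> \<open>W = - 1 - P\<close> by (simp add: algebra_simps)
    moreover have "5 dvd T + 1" using T1 by (simp add: cong_iff_dvd_diff)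
    ultimately have A5: "5 dvd A + 1" by simp
    have "[N + 1 = -1 + 3] (mod 5)"
      unfolding NT using T1 by (simp add: cong_iff_dvd_diff add.commute)
    then have "[A = 2 ^ X] (mod 5)" unfolding A_def by (auto intro: cong_pow)
    moreover have "[(2 :: int) ^ X = 2 ^ (X mod 4)] (mod 5)"
      by (rule power_cong_power_mod) (simp add: cong_def)
    ultimately have "[A = 1] (mod 5)" using X4 cong_trans by fastforce
    then have "5 dvd A - 1" by (simp add: cong_iff_dvd_diff)
    then have "5 dvd (A + 1) - (A - 1)" using A5 dvd_diff by blast
    then show False by simp
  qed
qed

lemma odd_z_solution:
  assumes z: "odd z"
  shows "a = 2 \<and> n = 2 \<and> x = 2 \<and> y = 1 \<and> z = 3"
proof -
  have Ndvd: "N dvd n ^ y + 2" using N_dvd_odd z by simp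
  have "n dvd n ^ y + 2" using Ndvd N by (metis dvd_mult_right)
  moreover have "n dvd n ^ y" using pos(2) by (simp add: dvd_power)
  ultimately have "n dvd 2" by (simp add: dvd_add_right_iff)
  then have "n \<le> 2" by (rule zdvd_imp_le) simp
  then have n2: "n = 2" using n by simp
  show ?thesis
  proof (cases "y = 1")
    case True
    then have "N \<le> 4" using Ndvd n2 by (intro zdvd_imp_le) simp_all
    then have N4: "N = 4" using N_ge by simp
    then have "a = 2" using N n2 by simp
    moreover have "x = 2 \<and> z = 3"
      using five_power_plus_2_eq_three_power[of x z] eq pos True n2 N4 by simp
    ultimately show ?thesis using True n2 by simp
  next
    case False
    then have y2: "y \<ge> 2" using pos by simp
    have y4: "n ^ y mod 4 = 0" using n_power_mod_4 y2 by simp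
    \<comment> \<open>If 4 divided \<open>N\<close>, the left side would be 1 and the right side 3;
      so \<open>N mod 4 = 2\<close>, which then makes \<open>x\<close> even.\<close>
    have "(N + 1) ^ x mod 4 = (N - 1) ^ z mod 4"
    proof -
      have "4 dvd n ^ y" using y4 by presburger
      moreover have "(N - 1) ^ z - (N + 1) ^ x = n ^ y" using eq by simp
      ultimately show ?thesis by (metis mod_eq_dvd_iff)
    qed
    then have m4: "(if even x then 1 else (N + 1) mod 4) = (N - 1) mod 4"
      using odd_power_mod_4[of "N + 1" x] odd_power_mod_4[of "N - 1" z] even_N z by simp
    have N4: "N mod 4 = 2"
    proof (rule ccontr)
      assume "N mod 4 \<noteq> 2"
      then have "(N - 1) mod 4 = 3" "(N + 1) mod 4 = 1" using even_N by presburger+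
      then show False using m4 by (simp split: if_splits)
    qed
    then have "(N - 1) mod 4 = 1" "(N + 1) mod 4 = 3" by presburger+
    then have x: "even x" using m4 by (simp split: if_splits)
    have False
    proof (cases "y = 2")
      case True
      then have "N dvd 6" using Ndvd n2 by simp
      then have "N \<le> 6" by (rule zdvd_imp_le) simp
      then have N6: "N = 6" using N_ge N4 by presburger
      \<comment> \<open>For \<open>N = 6\<close> the equation is \<open>7 ^ x + 4 = 5 ^ z\<close>,
        and modulo 7 no odd power of 5 is 4.\<close>
      have "7 dvd (5 :: int) ^ z - 4"
      proof -
        have "(5 :: int) ^ z - 4 = 7 ^ x" using eq N6 n2 True by simp
        then show ?thesis using pos(1) by (simp add: dvd_power)
      qed
      then have "(5 :: int) ^ z mod 7 = 4 mod 7" by (simp only: mod_eq_dvd_iff)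
      moreover have "[(5 :: int) ^ z = 5 ^ (z mod 6)] (mod 7)"
        by (rule power_cong_power_mod) (simp add: cong_def)
      ultimately have "(5 :: int) ^ (z mod 6) mod 7 = 4" by (simp add: cong_def)
      moreover have "odd (z mod 6)" "z mod 6 < 6" using z by (simp_all add: dvd_mod_iff)
      then have "z mod 6 = 1 \<or> z mod 6 = 3 \<or> z mod 6 = 5" by presburger
      ultimately show False by (elim disjE) simp_all
    next
      case False
      then have y3: "y \<ge> 3" using y2 by simp
      have "8 dvd n ^ y" using n_power_mod_8[OF y3] by presburger
      moreover have "(N - 1) ^ z - (N + 1) ^ x = n ^ y" using eq by simp
      ultimately have "(N - 1) ^ z mod 8 = (N + 1) ^ x mod 8" by (metis mod_eq_dvd_iff)
      then have "(N - 1) mod 8 = 1"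
        using odd_power_mod_8[of "N + 1" x] odd_power_mod_8[of "N - 1" z] even_N z x by simp
      then have N8: "N mod 8 = 2" by presburger
      have "even y" using y_even_2 N8 n2 by simp
      moreover from this have "y \<ge> 4" using y3 by presburger
      ultimately show False using odd_z_no_large_y[OF z n2 N8 x] by simp
    qed
    then show ?thesis ..
  qed
qed

end

theorem theorem1p1:
  fixes a m :: int and x y z :: nat
  assumes "a > 1" and "m > 0" and "x > 0" and "y > 0" and "z > 0"
  shows "(2 * a * m + 1) ^ x + (2 * m) ^ y = (2 * a * m - 1) ^ z \<longleftrightarrow>
    (a, m, x, y, z) = (2, 1, 2, 1, 3) \<or> (a, m, x, y, z) = (2, 1, 1, 2, 2)"
proof
  assume "(2 * a * m + 1) ^ x + (2 * m) ^ y = (2 * a * m - 1) ^ z"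
  then interpret shuffled_equation "2 * a * m" "2 * m" a x y z
    using assms by unfold_locales simp_all
  show "(a, m, x, y, z) = (2, 1, 2, 1, 3) \<or> (a, m, x, y, z) = (2, 1, 1, 2, 2)"
  proof (cases "even z")
    case True
    then show ?thesis using even_z_solution by simp
  next
    case False
    then show ?thesis using odd_z_solution by simp
  qed
qed auto

end
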